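(* Let $\Gamma$ be a bipartite distance-balanced graph for which there exists a $2$-cut $\{a,b\}$ with $d(a,b)=3$. Then either $\Gamma$ is a cycle, or there exist an integer $m\ge 2$ and an odd integer $\ell\ge 3$ such that $\Gamma$ is isomorphic to $W(m,\ell)$.
   Context: All graphs are finite, simple, undirected, connected; $d$ denotes distance. For $u,v$ let $W_{uv}=\{z: d(u,z)<d(v,z)\}$; a connected graph is distance-balanced if $|W_{uv}|=|W_{vu}|$ for all adjacent $u,v$. A $2$-cut is a set of two vertices whose removal disconnects the graph. For $m\ge2$, $\ell\ge3$ and $0\le i\le 4\ell-1$ let $f(i)=1$ if $i\equiv 0$ or $3\pmod 4$ and $f(i)=m$ otherwise; $W(m,\ell)$ is the graph with vertex set $\{(i,j):0\le i\le 4\ell-1,\ 1\le j\le f(i)\}$ in which $(i_1,j_1)\sim(i_2,j_2)$ iff $i_2-i_1\equiv\pm1\pmod{4\ell}$. *)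

theory Defs
  imports "Graph_Theory.Graph_Theory" "HOL-Number_Theory.Cong"
begin

text \<open>
  Finite simple undirected graphs are represented by the locale predicate \<^const>\<open>graph\<close>:
  finite symmetric digraphs without loops and parallel arcs. The relation
  \<^const>\<open>dominates\<close> is then adjacency.
\<close>

text \<open>The distance is the infimum of the walk costs for unit arc weights.\<close>

definition gdist :: "('a, 'b) pre_digraph \<Rightarrow> 'a \<Rightarrow> 'a \<Rightarrow> ereal" where
  "gdist G u v = wf_digraph.\<mu> G (\<lambda>_. 1) u v"

definition closer_set :: "('a, 'b) pre_digraph \<Rightarrow> 'a \<Rightarrow> 'a \<Rightarrow> 'a set" where
  "closer_set G u v = {z \<in> verts G. gdist G u z < gdist G v z}"

definition distance_balanced :: "('a, 'b) pre_digraph \<Rightarrow> bool" where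
  "distance_balanced G \<longleftrightarrow>
     Digraph_Component.connected G \<and>
     (\<forall>u v. u \<rightarrow>\<^bsub>G\<^esub> v \<longrightarrow> card (closer_set G u v) = card (closer_set G v u))"

definition bipartite :: "('a, 'b) pre_digraph \<Rightarrow> bool" where
  "bipartite G \<longleftrightarrow>
     (\<exists>X Y. verts G = X \<union> Y \<and> X \<inter> Y = {} \<and> arcs_ends G \<subseteq> X \<times> Y \<union> Y \<times> X)"

text \<open>
  The null graph does not count as connected in the library, so non-emptiness of the
  remaining vertex set has to be demanded separately.
\<close>

definition two_cut :: "('a, 'b) pre_digraph \<Rightarrow> 'a set \<Rightarrow> bool" where
  "two_cut G S \<longleftrightarrow>
     S \<subseteq> verts G \<and> card S = 2 \<and> verts G - S \<noteq> {} \<and>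
     \<not> Digraph_Component.connected (G \<restriction> (verts G - S))"

definition cycle_graph :: "nat \<Rightarrow> nat pair_pre_digraph" where
  "cycle_graph n =
     \<lparr> pverts = {0..<n},
       parcs = {(i, j). i < n \<and> j < n \<and>
         ([int j - int i = 1] (mod int n) \<or> [int j - int i = -1] (mod int n))} \<rparr>"

definition is_cycle_graph :: "('a, 'b) pre_digraph \<Rightarrow> bool" where
  "is_cycle_graph G \<longleftrightarrow> (\<exists>n\<ge>3. digraph_iso G (with_proj (cycle_graph n)))"

definition W_layer :: "nat \<Rightarrow> nat \<Rightarrow> nat" where
  "W_layer m i = (if [i = 0] (mod 4) \<or> [i = 3] (mod 4) then 1 else m)"

definition W_verts :: "nat \<Rightarrow> nat \<Rightarrow> (nat \<times> nat) set" where
  "W_verts m l = {(i, j). i < 4 * l \<and> 1 \<le> j \<and> j \<le> W_layer m i}"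

definition W_graph :: "nat \<Rightarrow> nat \<Rightarrow> (nat \<times> nat) pair_pre_digraph" where
  "W_graph m l =
     \<lparr> pverts = W_verts m l,
       parcs = {((i1, j1), (i2, j2)). (i1, j1) \<in> W_verts m l \<and> (i2, j2) \<in> W_verts m l \<and>
         ([int i2 - int i1 = 1] (mod int (4 * l)) \<or> [int i2 - int i1 = -1] (mod int (4 * l)))} \<rparr>"

lemma gdist_eq_Least_length:
  assumes "wf_digraph G" and "u \<rightarrow>\<^sup>*\<^bsub>G\<^esub> v"
  shows "gdist G u v = ereal (real (LEAST n. \<exists>p. pre_digraph.awalk G u p v \<and> length p = n))"
proof -
  interpret wf_digraph G by fact
  let ?P = "\<lambda>n. \<exists>p. awalk u p v \<and> length p = n"
  have cost: "awalk_cost (\<lambda>_. 1) p = real (length p)" for p :: "'b list"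
    by (induction p) auto
  obtain q where "awalk u q v" using assms(2) by (auto simp: reachable_awalk)
  then have "?P (length q)" by blast
  then have "?P (LEAST n. ?P n)" by (rule LeastI)
  then obtain p where p: "awalk u p v" "length p = (LEAST n. ?P n)" by blast
  have le: "(LEAST n. ?P n) \<le> length q" if "awalk u q v" for q
    using that by (intro Least_le) blast
  have "(INF p\<in>{p. awalk u p v}. ereal (awalk_cost (\<lambda>_. 1) p)) = ereal (real (LEAST n. ?P n))"
  proof (rule INF_eqI)
    fix i assume "i \<in> {p. awalk u p v}"
    then show "ereal (real (LEAST n. ?P n)) \<le> ereal (awalk_cost (\<lambda>_. 1) i)"
      using le by (simp add: cost)
  next
    fix y assume "\<And>i. i \<in> {p. awalk u p v} \<Longrightarrow> y \<le> ereal (awalk_cost (\<lambda>_. 1) i)"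
    from this[of p] show "y \<le> ereal (real (LEAST n. ?P n))"
      using p by (simp add: cost)
  qed
  then show ?thesis by (simp add: gdist_def \<mu>_def)
qed

lemma cong_diff_swap_iff:
  "[int a - int b = - 1] (mod n) \<longleftrightarrow> [int b - int a = 1] (mod n)"
  using cong_minus_minus_iff[of "int b - int a" 1 n] by simp

lemma graph_cycle_graph:
  assumes "n \<ge> 2"
  shows "graph (with_proj (cycle_graph n))"
proof -
  have fin: "finite (parcs (cycle_graph n))"
    by (rule finite_subset[of _ "{0..<n} \<times> {0..<n}"]) (auto simp: cycle_graph_def)
  have "\<not> [0 = 1] (mod int n)"
    using assms by (auto simp: cong_def)
  then have "pair_graph (cycle_graph n)"
    using fin
    by unfold_locales
       (auto simp: cycle_graph_def symmetric_def sym_def cong_diff_swap_iff)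
  then show ?thesis by (rule pair_graph.pair_graphD_graph)
qed

lemma graph_W_graph:
  assumes "l \<ge> 1"
  shows "graph (with_proj (W_graph m l))"
proof -
  have fv: "finite (W_verts m l)"
    by (rule finite_subset[of _ "{0..<4 * l} \<times> {0..max 1 m}"])
       (auto simp: W_verts_def W_layer_def split: if_splits)
  have fin: "finite (parcs (W_graph m l))"
    by (rule finite_subset[of _ "W_verts m l \<times> W_verts m l"])
       (auto simp: W_graph_def fv)
  have "\<not> [0 = 1] (mod int (4 * l))"
    using assms by (auto simp: cong_def)
  then have "pair_graph (W_graph m l)"
    using fin fv
    by unfold_locales
       (auto simp: W_graph_def symmetric_def sym_def cong_diff_swap_iff)
  then show ?thesis by (rule pair_graph.pair_graphD_graph)
qed

end

theory Submission
  imports Defs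
begin

text \<open>
  In a bipartite distance-balanced graph every set \<open>W\<^sub>u\<^sub>v\<close> of an edge \<open>uv\<close> contains exactly half of
  the vertices. Hence, if a set with less than half of the vertices can be left only through two
  vertices \<open>s\<close> and \<open>t\<close>, then the sum of the distances from \<open>s\<close> and \<open>t\<close> is constant along the
  edges inside the set. On the smaller side of a 2-cut \<open>{a, b}\<close> this sum is 3, so that side consists
  of a set \<open>A\<close> of neighbours of \<open>a\<close> and a set \<open>B\<close> of neighbours of \<open>b\<close>. On the other side let \<open>Q\<close> be
  the vertices nearer to \<open>b\<close> and \<open>R\<close> those nearer to \<open>a\<close>. Counting \<open>W\<^sub>u\<^sub>a\<close> and \<open>W\<^sub>v\<^sub>b\<close> for \<open>u \<in> A\<close>
  and \<open>v \<in> B\<close> shows that \<open>A\<close> and \<open>B\<close> form a complete bipartite graph with parts of equal size \<open>m\<close>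
  and that a single edge \<open>xy\<close> joins \<open>Q\<close> to \<open>R\<close>. The sum argument now makes \<open>Q\<close> the interval
  between \<open>b\<close> and \<open>x\<close>, and \<open>R\<close> the interval between \<open>a\<close> and \<open>y\<close>. For edges inside these intervals,
  \<open>|W\<^sub>u\<^sub>v| = |V|/2\<close> becomes a linear recursion between the level sizes of \<open>Q\<close> and \<open>R\<close>, perturbed by
  nonnegative terms measuring how far the intervals are from having complete bipartite graphs
  between consecutive levels. The perturbations vanish and the level sizes repeat with period 4 as
  \<open>1, 1, m, m\<close> and \<open>1, m, m, 1\<close>.
\<close>


section \<open>Graph metrics\<close>

locale graph_metric =
  fixes V :: "'a set" and adj :: "'a \<Rightarrow> 'a \<Rightarrow> bool" and d :: "'a \<Rightarrow> 'a \<Rightarrow> nat"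
  assumes adj_V: "adj u v \<Longrightarrow> u \<in> V \<and> v \<in> V"
    and d_eq_0_iff: "u \<in> V \<Longrightarrow> v \<in> V \<Longrightarrow> d u v = 0 \<longleftrightarrow> u = v"
    and d_commute: "d u v = d v u"
    and d_triangle: "u \<in> V \<Longrightarrow> v \<in> V \<Longrightarrow> w \<in> V \<Longrightarrow> d u w \<le> d u v + d v w"
    and d_eq_1_iff: "u \<in> V \<Longrightarrow> v \<in> V \<Longrightarrow> d u v = 1 \<longleftrightarrow> adj u v"
    and d_step: "u \<in> V \<Longrightarrow> v \<in> V \<Longrightarrow> u \<noteq> v \<Longrightarrow> \<exists>w. adj u w \<and> d u v = Suc (d w v)"
begin

lemma d_self [simp]: "u \<in> V \<Longrightarrow> d u u = 0"
  by (simp add: d_eq_0_iff)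

lemma d_adj: "adj u v \<Longrightarrow> d u v = 1"
  using adj_V d_eq_1_iff by blast

lemma adj_commute: "adj u v \<longleftrightarrow> adj v u"
  by (metis adj_V d_commute d_eq_1_iff)

lemma d_le_Suc_adj: "adj u v \<Longrightarrow> z \<in> V \<Longrightarrow> d u z \<le> Suc (d v z)"
  using d_triangle[of u v z] d_adj[of u v] adj_V[of u v] by simp

lemma d_le_Suc_adj': "adj u v \<Longrightarrow> z \<in> V \<Longrightarrow> d z u \<le> Suc (d z v)"
  using d_le_Suc_adj d_commute by metis

lemma d_step': "u \<in> V \<Longrightarrow> v \<in> V \<Longrightarrow> u \<noteq> v \<Longrightarrow> \<exists>w. adj w v \<and> d u v = Suc (d u w)"
  using d_step[of v u] d_commute adj_commute by metis

definition closer :: "'a \<Rightarrow> 'a \<Rightarrow> 'a set" where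
  "closer u v = {z \<in> V. d u z < d v z}"

definition behind :: "'a \<Rightarrow> 'a \<Rightarrow> 'a set" where
  "behind s t = {z \<in> V. d t z = d t s + d s z}"

definition nbrs_in :: "'a set \<Rightarrow> 'a \<Rightarrow> 'a set" where
  "nbrs_in C u = {v \<in> C. adj u v}"

definition separates :: "'a set \<Rightarrow> 'a set \<Rightarrow> bool" where
  "separates S C \<longleftrightarrow> S \<subseteq> V \<and> C \<subseteq> V - S \<and> (\<forall>u\<in>C. \<forall>v. adj u v \<longrightarrow> v \<in> C \<union> S)"

definition guards :: "'a set \<Rightarrow> 'a set \<Rightarrow> bool" where
  "guards S C \<longleftrightarrow> S \<subseteq> V \<and> C \<subseteq> V \<and> (\<forall>u\<in>C. \<forall>z\<in>V - C. \<exists>s\<in>S. d u z = d s u + d s z)"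

lemma separates_imp_guards:
  assumes sep: "separates S (C - S)" and "C \<subseteq> V"
  shows "guards S C"
proof -
  have "\<exists>s\<in>S. d u z = d s u + d s z" if "u \<in> C" "z \<in> V - C" for u z
    using that(1)
  proof (induction "d u z" arbitrary: u rule: less_induct)
    case less
    have V: "u \<in> V" "z \<in> V" "u \<noteq> z" "S \<subseteq> V"
      using less.prems that(2) assms by (auto simp: separates_def)
    show ?case
    proof (cases "u \<in> S")
      case True
      then show ?thesis using V by (intro bexI[of _ u]) auto
    next
      case False
      obtain w where w: "adj u w" "d u z = Suc (d w z)" using d_step V by blast
      have "w \<in> C \<union> S" using sep less.prems False w by (auto simp: separates_def)
      then consider (S) "w \<in> S" | (C) "w \<in> C" by blast
      then show ?thesis
      proof cases
        case S
        then show ?thesis using w d_adj[OF w(1)] d_commute[of u w] by (intro bexI[of _ w]) auto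
      next
        case C
        then obtain s where s: "s \<in> S" "d w z = d s w + d s z" using less.hyps w by auto
        have "d s u \<le> Suc (d s w)"
          using d_le_Suc_adj'[OF w(1), of s] s V by auto
        moreover have "d u z \<le> d s u + d s z"
          using d_triangle[of u s z] V s d_commute[of u s] by auto
        ultimately show ?thesis using s w by (intro bexI[of _ s]) auto
      qed
    qed
  qed
  then show ?thesis using assms by (auto simp: guards_def separates_def)
qed

lemma separates_empty_imp:
  assumes "separates {} C"
  shows "C = {} \<or> C = V"
  using separates_imp_guards[of "{}" C] assms by (auto simp: guards_def separates_def)

lemma separates_complement: "separates S C \<Longrightarrow> separates S (V - S - C)"
  unfolding separates_def using adj_V adj_commute by blast

lemma separates_insertD:
  "separates (insert s S) C \<Longrightarrow> nbrs_in C s = {} \<Longrightarrow> separates S C"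
  unfolding separates_def nbrs_in_def using adj_commute by blast

end

locale bipartite_metric = graph_metric +
  assumes d_adj_neq: "adj u v \<Longrightarrow> z \<in> V \<Longrightarrow> d z u \<noteq> d z v"
begin

lemma d_adj_cases:
  assumes "adj u v" "z \<in> V"
  shows "d z u = Suc (d z v) \<or> d z v = Suc (d z u)"
proof -
  have "d z u \<le> Suc (d z v)" "d z v \<le> Suc (d z u)"
    using d_le_Suc_adj'[of u v z] d_le_Suc_adj'[of v u z] assms adj_commute[of u v] by auto
  then show ?thesis using d_adj_neq[OF assms] by linarith
qed

lemma even_d_triangle:
  assumes "u \<in> V" "v \<in> V" "z \<in> V"
  shows "even (d z u + d z v + d u v)"
  using assms(1)
proof (induction "d u v" arbitrary: u)
  case 0
  then show ?case using d_eq_0_iff[of u v] assms by simp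
next
  case (Suc n)
  then have "u \<noteq> v" using assms(2) by auto
  then obtain w where w: "adj u w" "d u v = Suc (d w v)" using d_step Suc.prems assms(2) by blast
  then have "even (d z w + d z v + d w v)" using Suc adj_V by simp
  then show ?case using d_adj_cases[OF w(1) assms(3)] w(2) by auto
qed

end

locale balanced_metric = bipartite_metric +
  assumes finite_V: "finite V"
    and card_closer_commute: "adj u v \<Longrightarrow> card (closer u v) = card (closer v u)"
begin

lemma card_closer:
  assumes "adj u v"
  shows "2 * card (closer u v) = card V"
proof -
  have "V = closer u v \<union> closer v u"
    using d_adj_neq[OF assms] d_commute by (fastforce simp: closer_def neq_iff)
  moreover have "card (closer u v \<union> closer v u) = card (closer u v) + card (closer v u)"
    using finite_V by (intro card_Un_disjoint) (auto simp: closer_def)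
  ultimately show ?thesis using card_closer_commute[OF assms] by simp
qed

lemma card_V_le_guarded:
  assumes guards: "guards S C" and uv: "u \<in> C" "adj u v"
    and nearer: "\<And>s. s \<in> S \<Longrightarrow> d s v \<le> d s u"
  shows "card V \<le> 2 * card C"
proof -
  have C: "S \<subseteq> V" "C \<subseteq> V" using guards by (auto simp: guards_def)
  have "closer u v \<subseteq> C"
  proof
    fix z assume z: "z \<in> closer u v"
    show "z \<in> C"
    proof (rule ccontr)
      assume "z \<notin> C"
      then obtain s where s: "s \<in> S" "d u z = d s u + d s z"
        using guards uv(1) z unfolding guards_def closer_def by blast
      have "d v z \<le> d s v + d s z"
        using d_triangle[of v s z] d_commute[of v s] s C adj_V[OF uv(2)] z
        by (auto simp: closer_def)
      then show False using nearer[OF s(1)] s(2) z by (simp add: closer_def)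
    qed
  qed
  then have "card (closer u v) \<le> card C" using C finite_V by (meson card_mono finite_subset)
  then show ?thesis using card_closer[OF uv(2)] by simp
qed

text \<open>If both distances grew or both shrank along the edge, one of its two closer sets would be
  contained in \<open>C\<close>.\<close>

lemma d_sum_edge:
  assumes guards: "guards {s, t} C" and small: "2 * card C < card V"
    and uv: "u \<in> C" "v \<in> C" "adj u v"
  shows "d s u + d t u = d s v + d t v"
proof -
  have V: "s \<in> V" "t \<in> V" using guards by (auto simp: guards_def)
  have no_retreat: "\<not> (d s q \<le> d s p \<and> d t q \<le> d t p)" if "p \<in> C" "adj p q" for p q
    using card_V_le_guarded[OF guards that] small by auto
  show ?thesis
    using d_adj_cases[OF uv(3) V(1)] d_adj_cases[OF uv(3) V(2)]
      no_retreat[OF uv(1,3)] no_retreat[of v u] uv(2,3) adj_commute[of u v] by auto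
qed

lemma card_V_le_cut_vertex:
  assumes sep: "separates {a} C" and "C \<noteq> {}"
  shows "card V \<le> 2 * card C"
proof -
  have aV: "a \<in> V" "a \<notin> C" "C \<subseteq> V" using sep by (auto simp: separates_def)
  have "nbrs_in C a \<noteq> {}"
    using separates_insertD[OF sep] separates_empty_imp[of C] \<open>C \<noteq> {}\<close> aV by blast
  then obtain u where u: "u \<in> C" "adj u a" by (auto simp: nbrs_in_def adj_commute)
  have "guards {a} C" using sep aV by (intro separates_imp_guards) simp_all
  then show ?thesis using u by (rule card_V_le_guarded) (use aV in simp)
qed

lemma no_cut_vertex:
  assumes sep: "separates {a} C" and "C \<noteq> {}"
  shows "C = V - {a}"
proof (rule ccontr)
  assume "C \<noteq> V - {a}"
  have C: "C \<subseteq> V - {a}" "a \<in> V" using sep by (auto simp: separates_def)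
  have "card (V - {a}) = card C + card (V - {a} - C)"
    using card_Int_Diff[of "V - {a}" C] finite_V C by (simp add: inf_absorb2)
  moreover have "card (V - {a}) < card V" using C finite_V by (intro card_Diff1_less)
  moreover have "card V \<le> 2 * card (V - {a} - C)"
    using separates_complement[OF sep] C \<open>C \<noteq> V - {a}\<close> by (intro card_V_le_cut_vertex) auto
  moreover have "card V \<le> 2 * card C" using assms by (rule card_V_le_cut_vertex)
  ultimately show False by linarith
qed

lemma nbrs_in_two_cut_nonempty:
  assumes "separates {a, b} C" "C \<noteq> {}" "a \<noteq> b"
  shows "nbrs_in C a \<noteq> {}" "nbrs_in C b \<noteq> {}"
proof -
  have "nbrs_in C s \<noteq> {}" if "separates {s, t} C" "s \<noteq> t" for s t
    using separates_insertD[OF that(1)] no_cut_vertex[of t C] that assms(2)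
    by (auto simp: separates_def)
  then show "nbrs_in C a \<noteq> {}" "nbrs_in C b \<noteq> {}" using assms insert_commute[of a b "{}"] by metis+
qed

end

section \<open>Levels and excess of an interval\<close>

locale interval = bipartite_metric +
  fixes b x :: 'a and k :: nat and Q :: "'a set"
  assumes ends_V: "b \<in> V" "x \<in> V"
    and d_b_x: "d b x = k"
    and Q_eq: "Q = {z \<in> V. d b z + d x z = k}"
    and finite_Q: "finite Q"
begin

lemma ends_in_Q: "b \<in> Q" "x \<in> Q"
  using ends_V d_b_x d_commute[of b x] by (auto simp: Q_eq)

lemma Q_V: "z \<in> Q \<Longrightarrow> z \<in> V"
  by (simp add: Q_eq)

lemma d_sum_Q: "z \<in> Q \<Longrightarrow> d b z + d x z = k"
  by (simp add: Q_eq)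

lemma d_b_le: "z \<in> Q \<Longrightarrow> d b z \<le> k"
  using d_sum_Q by force

lemma step_down:
  assumes z: "z \<in> Q" "z \<noteq> b"
  obtains w where "w \<in> Q" "adj w z" "d b z = Suc (d b w)"
proof -
  obtain w where w: "adj w z" "d b z = Suc (d b w)" using d_step'[of b z] z Q_V ends_V by blast
  have V: "w \<in> V" using adj_V w(1) by blast
  have "d x w \<le> Suc (d x z)" using d_le_Suc_adj'[OF w(1)] ends_V by simp
  moreover have "k \<le> d b w + d x w"
    using d_triangle[of b w x] d_b_x ends_V V d_commute[of w x] by simp
  ultimately have "w \<in> Q" using d_sum_Q[OF z(1)] w(2) V by (simp add: Q_eq)
  then show ?thesis using that w by simp
qed

definition level :: "nat \<Rightarrow> 'a set" where
  "level i = {z \<in> Q. d b z = i}"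

definition above :: "nat \<Rightarrow> 'a set" where
  "above i = {z \<in> Q. i < d b z}"

definition below :: "nat \<Rightarrow> 'a set" where
  "below i = {z \<in> Q. d b z < i}"

lemma finite_parts: "finite (level i)" "finite (above i)" "finite (below i)"
  using finite_Q by (auto simp: level_def above_def below_def)

lemma adj_from_level_below:
  assumes "t \<in> level (Suc i)"
  obtains z where "z \<in> level i" "adj z t"
proof -
  have t: "t \<in> Q" "d b t = Suc i" using assms by (auto simp: level_def)
  then have "t \<noteq> b" using ends_V by auto
  then obtain z where "z \<in> Q" "adj z t" "d b t = Suc (d b z)" using step_down t by blast
  then show ?thesis using that t by (simp add: level_def)
qed

lemma card_above: "card (above i) = card (level (Suc i)) + card (above (Suc i))"
proof -
  have "above i = level (Suc i) \<union> above (Suc i)" by (auto simp: above_def level_def)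
  moreover have "level (Suc i) \<inter> above (Suc i) = {}" by (auto simp: above_def level_def)
  ultimately show ?thesis using finite_parts by (simp add: card_Un_disjoint)
qed

lemma above_k: "above k = {}"
  using d_b_le by (auto simp: above_def not_less)

lemma level_0: "level 0 = {b}"
  using ends_in_Q ends_V d_eq_0_iff Q_V by (auto simp: level_def)

lemma card_Q: "card Q = 1 + card (above 0)"
proof -
  have "Q = level 0 \<union> above 0" by (auto simp: level_def above_def)
  then have "card Q = card (level 0 \<union> above 0)" by (rule arg_cong)
  also have "\<dots> = card (level 0) + card (above 0)"
    using finite_parts by (intro card_Un_disjoint) (auto simp: level_def above_def)
  finally show ?thesis by (simp add: level_0)
qed

lemma descend:
  assumes "z \<in> Q" "i \<le> d b z"
  shows "\<exists>p\<in>level i. d b z = i + d z p"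
  using assms
proof (induction "d b z - i" arbitrary: z)
  case 0
  then show ?case using Q_V by (intro bexI[of _ z]) (auto simp: level_def)
next
  case (Suc n)
  then have "z \<noteq> b" using ends_V by auto
  then obtain w where w: "w \<in> Q" "adj w z" "d b z = Suc (d b w)"
    using step_down Suc.prems by blast
  have "n = d b w - i" "i \<le> d b w" using w(3) Suc.hyps(2) by linarith+
  then obtain p where p: "p \<in> level i" "d b w = i + d w p" using Suc.hyps(1) w(1) by blast
  have V: "z \<in> V" "p \<in> V" "d b p = i" using p Suc.prems Q_V by (auto simp: level_def)
  have "d z p \<le> Suc (d w p)" using d_le_Suc_adj[of z w p] w(2) adj_commute V by simp
  moreover have "d b z \<le> i + d z p" using d_triangle[of b p z] V ends_V d_commute[of p z] by simp
  ultimately show ?case using p w by (intro bexI[of _ p]) auto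
qed

lemma level_nonempty: "i \<le> k \<Longrightarrow> level i \<noteq> {}"
  using descend[of x i] ends_in_Q d_b_x by auto

lemma card_level_pos: "i \<le> k \<Longrightarrow> 1 \<le> card (level i)"
  using level_nonempty finite_parts by (simp add: Suc_le_eq card_gt_0_iff)

text \<open>The least distance that two vertices of the interval can have given their levels; distinct
  vertices of one level have even positive distance.\<close>

definition level_dist :: "'a \<Rightarrow> 'a \<Rightarrow> int" where
  "level_dist z y =
    (if z = y then 0 else if d b z = d b y then 2 else \<bar>int (d b z) - int (d b y)\<bar>)"

definition slack :: "'a \<Rightarrow> 'a \<Rightarrow> int" where
  "slack z y = int (d z y) - level_dist z y"

definition excess :: "'a \<Rightarrow> int" where
  "excess z = (\<Sum>y\<in>Q. slack z y)"

lemma slack_commute: "slack z y = slack y z"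
  by (auto simp: slack_def level_dist_def d_commute[of z y])

lemma slack_nonneg:
  assumes "z \<in> Q" "y \<in> Q"
  shows "0 \<le> slack z y"
proof -
  have V: "z \<in> V" "y \<in> V" using assms Q_V by auto
  have "d b z \<le> d b y + d z y" "d b y \<le> d b z + d z y"
    using d_triangle[of b y z] d_triangle[of b z y] V ends_V d_commute[of y z] by auto
  moreover have "2 \<le> d z y" if "z \<noteq> y" "d b z = d b y"
  proof -
    have "d z y \<noteq> 0" using that V d_eq_0_iff by blast
    moreover have "d z y \<noteq> 1" using that V ends_V d_eq_1_iff d_adj_neq by blast
    ultimately show ?thesis by linarith
  qed
  ultimately show ?thesis by (auto simp: slack_def level_dist_def)
qed

lemma excess_nonneg: "z \<in> Q \<Longrightarrow> 0 \<le> excess z"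
  unfolding excess_def using slack_nonneg by (intro sum_nonneg)

lemma slack_eq_0: "z \<in> Q \<Longrightarrow> excess z = 0 \<Longrightarrow> y \<in> Q \<Longrightarrow> slack z y = 0"
  unfolding excess_def using slack_nonneg finite_Q by (metis sum_nonneg_eq_0_iff)

lemma excess_split:
  "excess z = sum (slack z) (below i) + sum (slack z) (level i) + sum (slack z) (above i)"
proof -
  have "Q = below i \<union> level i \<union> above i" by (auto simp: below_def level_def above_def)
  moreover have "(below i \<union> level i) \<inter> above i = {}" "below i \<inter> level i = {}"
    by (auto simp: below_def level_def above_def)
  then have "sum (slack z) (below i \<union> level i \<union> above i) =
      sum (slack z) (below i) + sum (slack z) (level i) + sum (slack z) (above i)"
    using finite_parts by (simp add: sum.union_disjoint)
  ultimately show ?thesis by (simp add: excess_def)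
qed

lemma slack_diff_upward_edge:
  assumes zw: "adj z w" "d b w = Suc (d b z)" and p: "p \<in> Q"
  shows "slack z p - slack w p = 2 * of_bool (d w p < d z p) - 2 * of_bool (d b p = d b z)
    - 2 * of_bool (Suc (d b z) < d b p) + 2 * of_bool (p = z) - 2 * of_bool (p = w)"
proof -
  have "z \<noteq> w" using zw(2) by auto
  have "int (d z p) - int (d w p) = 2 * of_bool (d w p < d z p) - 1"
    using d_adj_cases[OF zw(1), of p] p Q_V d_commute[of p z] d_commute[of p w] by auto
  moreover have "level_dist z p - level_dist w p = 2 * of_bool (d b p = d b z)
      + 2 * of_bool (Suc (d b z) < d b p) - 1 - 2 * of_bool (p = z) + 2 * of_bool (p = w)"
    using \<open>z \<noteq> w\<close> zw(2) by (auto simp: level_dist_def)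
  ultimately show ?thesis by (simp add: slack_def)
qed

lemma excess_diff_upward_edge:
  assumes zw: "z \<in> Q" "w \<in> Q" "adj z w" "d b w = Suc (d b z)"
  shows "excess z - excess w =
    2 * int (card {p \<in> Q. d w p < d z p}) - 2 * int (card (level (d b z)))
      - 2 * int (card (above (Suc (d b z))))"
proof -
  have count: "(\<Sum>p\<in>Q. of_bool (S p)) = int (card {p \<in> Q. S p})" for S
    using finite_Q by (simp add: Int_def)
  have single: "{p \<in> Q. p = z} = {z}" "{p \<in> Q. p = w} = {w}" using zw by auto
  have "excess z - excess w = (\<Sum>p\<in>Q. 2 * of_bool (d w p < d z p) - 2 * of_bool (d b p = d b z)
      - 2 * of_bool (Suc (d b z) < d b p) + 2 * of_bool (p = z) - 2 * of_bool (p = w))"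
    unfolding excess_def sum_subtractf[symmetric]
    by (rule sum.cong[OF refl slack_diff_upward_edge[OF zw(3,4)]])
  also have "\<dots> = 2 * int (card {p \<in> Q. d w p < d z p}) - 2 * int (card (level (d b z)))
      - 2 * int (card (above (Suc (d b z))))"
    unfolding level_def above_def
    by (simp only: sum_subtractf sum.distrib sum_distrib_left[symmetric] count single) simp
  finally show ?thesis .
qed

lemma adj_if_slack_eq_0:
  assumes "z \<in> Q" "y \<in> Q" "d b z = Suc (d b y)" "slack z y = 0"
  shows "adj z y"
  using assms Q_V d_eq_1_iff[of z y] by (auto simp: slack_def level_dist_def split: if_splits)

lemma slack_upward_edge:
  assumes "z \<in> Q" "t \<in> Q" "adj z t" "d b t = Suc (d b z)"
  shows "slack z t = 0"
  using assms d_adj by (auto simp: slack_def level_dist_def)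

lemma slack_le_adj:
  assumes "adj z t" "y \<in> Q" "level_dist z y = level_dist t y + 1"
  shows "slack z y \<le> slack t y"
  using d_le_Suc_adj[OF assms(1), of y] Q_V[OF assms(2)] assms(3) by (simp add: slack_def)

end

sublocale interval \<subseteq> rev: interval V adj d x b k Q
  by unfold_locales (use ends_V d_b_x d_commute[of b x] Q_eq finite_Q in \<open>auto simp: add.commute\<close>)

context interval
begin

lemma rev_level:
  assumes "i \<le> k"
  shows "rev.level i = level (k - i)"
proof -
  have "d x z = i \<longleftrightarrow> d b z = k - i" if "z \<in> Q" for z
    using d_sum_Q[OF that] assms by linarith
  then show ?thesis by (auto simp: level_def rev.level_def)
qed

lemma level_k: "level k = {x}"
  using rev.level_0 rev_level[of 0] by simp

lemma ascend:
  assumes "z \<in> Q" "d b z \<le> i" "i \<le> k"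
  shows "\<exists>p\<in>level i. d b z + d z p = i"
proof -
  have "\<exists>p\<in>level i. d x z = k - i + d z p"
    using rev.descend[OF assms(1), of "k - i"] rev_level[of "k - i"] assms d_sum_Q[OF assms(1)]
    by simp
  then obtain p where "p \<in> level i" "d x z = k - i + d z p" by blast
  moreover from this have "d b z + d z p = i" using d_sum_Q[OF assms(1)] assms by linarith
  ultimately show ?thesis by blast
qed

lemma rev_excess:
  assumes "z \<in> Q"
  shows "rev.excess z = excess z"
proof -
  have "rev.slack z y = slack z y" if "y \<in> Q" for y
  proof -
    have "int (d x z) = int k - int (d b z)" "int (d x y) = int k - int (d b y)"
      using d_sum_Q[OF assms] d_sum_Q[OF that] by linarith+
    then show ?thesis
      by (simp add: slack_def rev.slack_def level_dist_def rev.level_dist_def abs_minus_commute)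
  qed
  then show ?thesis by (simp add: excess_def rev.excess_def)
qed

lemma excess_singleton_level:
  assumes z: "z \<in> Q" "level (d b z) = {z}"
  shows "excess z = 0"
  unfolding excess_def
proof (rule sum.neutral, rule ballI)
  fix y assume y: "y \<in> Q"
  have "y = z" if "d b y = d b z" using that y z(2) by (auto simp: level_def)
  then consider (self) "y = z" | (above) "d b z < d b y" | (below) "d b y < d b z" by linarith
  then show "slack z y = 0"
  proof cases
    case self
    then show ?thesis using Q_V[OF y] by (simp add: slack_def level_dist_def)
  next
    case above
    then have "d b y = d b z + d z y" using descend[OF y, of "d b z"] z(2) d_commute[of y z] by auto
    then show ?thesis using above by (auto simp: slack_def level_dist_def)
  next
    case below
    then have "d b y + d z y = d b z"
      using ascend[OF y, of "d b z"] z d_b_le[OF z(1)] d_commute[of y z] by auto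
    then show ?thesis using below by (auto simp: slack_def level_dist_def)
  qed
qed

end

locale regular_interval = interval +
  assumes excess_cong: "z \<in> Q \<Longrightarrow> w \<in> Q \<Longrightarrow> d b z = d b w \<Longrightarrow> excess z = excess w"
begin

definition level_excess :: "nat \<Rightarrow> int" where
  "level_excess i = excess (SOME z. z \<in> level i)"

lemma excess_eq_level_excess:
  assumes "z \<in> Q"
  shows "excess z = level_excess (d b z)"
proof -
  define w where "w = (SOME w. w \<in> level (d b z))"
  have "w \<in> level (d b z)"
    unfolding w_def by (rule someI[of _ z]) (simp add: level_def assms)
  then have "excess z = excess w" using excess_cong[of z w] assms by (simp add: level_def)
  then show ?thesis by (simp add: level_excess_def w_def)
qed

lemma level_excess_eq: "z \<in> level i \<Longrightarrow> level_excess i = excess z"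
  using excess_eq_level_excess by (auto simp: level_def)

end

sublocale regular_interval \<subseteq> rev: regular_interval V adj d x b k Q
proof
  fix z w assume zw: "z \<in> Q" "w \<in> Q" "d x z = d x w"
  then have "d b z = d b w" using d_sum_Q[of z] d_sum_Q[of w] by linarith
  then show "rev.excess z = rev.excess w" using excess_cong[OF zw(1,2)] rev_excess zw(1,2) by simp
qed

context regular_interval
begin

lemma rev_level_excess:
  assumes "i \<le> k"
  shows "rev.level_excess i = level_excess (k - i)"
proof -
  obtain z where z: "z \<in> level (k - i)" using level_nonempty[of "k - i"] by auto
  then have "z \<in> rev.level i" "z \<in> Q" using rev_level[OF assms] by (auto simp: level_def)
  then show ?thesis using level_excess_eq[OF z] rev.level_excess_eq[of z i] rev_excess[of z] by simp
qed

lemma level_excess_nonneg: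
  assumes "i \<le> k"
  shows "0 \<le> level_excess i"
proof -
  obtain z where z: "z \<in> level i" using level_nonempty[OF assms] by auto
  then show ?thesis using level_excess_eq[OF z] excess_nonneg[of z] by (simp add: level_def)
qed

lemma level_excess_singleton:
  assumes "card (level i) = 1"
  shows "level_excess i = 0"
proof -
  obtain z where z: "level i = {z}" using assms by (auto simp: card_1_singleton_iff)
  then have "z \<in> Q" "d b z = i" by (auto simp: level_def)
  then show ?thesis using excess_singleton_level[of z] level_excess_eq[of z i] z by simp
qed

lemma level_excess_ends: "level_excess 0 = 0" "level_excess k = 0"
  using level_excess_singleton level_0 level_k by simp_all

lemma slack_eq_0_next_level:
  assumes no_excess: "level_excess i = 0" and z: "z \<in> level (Suc i)"
    and y: "y \<in> Q" "d b y \<le> Suc i"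
  shows "slack z y = 0"
proof -
  have zQ: "z \<in> Q" "d b z = Suc i" using z by (auto simp: level_def)
  have slack_level_i: "slack p q = 0" if "p \<in> Q" "d b p = i" "q \<in> Q" for p q
    using slack_eq_0 excess_eq_level_excess that no_excess by simp
  obtain p where "p \<in> level i" "adj p z" using adj_from_level_below[OF z] .
  then have p: "p \<in> Q" "adj p z" "d b p = i" by (auto simp: level_def)
  consider (self) "y = z" | (level_i) "d b y = i" | (other) "y \<noteq> z" "d b y \<noteq> i" by blast
  then show ?thesis
  proof cases
    case self
    then show ?thesis using Q_V y by (simp add: slack_def level_dist_def)
  next
    case level_i
    then show ?thesis using slack_level_i[of y z] y zQ slack_commute by simp
  next
    case other
    then have "level_dist z y = level_dist p y + 1" using p(3) y zQ by (auto simp: level_dist_def)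
    then have "slack z y \<le> slack p y" using p y adj_commute by (intro slack_le_adj) auto
    then show ?thesis using slack_level_i[of p y] slack_nonneg[of z y] p y zQ by simp
  qed
qed

lemma slack_le_2:
  assumes no_excess: "level_excess i = 0" and z: "z \<in> level (Suc i)" and y: "y \<in> level (Suc (Suc i))"
  shows "slack z y \<le> 2"
proof -
  have zQ: "z \<in> Q" "d b z = Suc i" and yQ: "y \<in> Q" "d b y = Suc (Suc i)"
    using z y by (auto simp: level_def)
  obtain p where "p \<in> level (Suc i)" "adj p y" using adj_from_level_below[OF y] .
  then have p: "p \<in> Q" "adj p y" "d b p = Suc i" by (auto simp: level_def)
  have "slack z p = 0" using slack_eq_0_next_level[OF no_excess z] p yQ by simp
  then have "d z p \<le> 2" using p(3) zQ yQ by (auto simp: slack_def level_dist_def split: if_splits)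
  then have "d z y \<le> 3" using d_le_Suc_adj'[of y p z] p(2) zQ Q_V adj_commute by simp
  then show ?thesis using zQ yQ by (auto simp: slack_def level_dist_def)
qed

lemma excess_le_upward_edge:
  assumes no_excess: "level_excess i = 0"
    and z: "z \<in> level (Suc i)" and t: "t \<in> level (Suc (Suc i))" and "adj z t"
  shows "excess z \<le> sum (slack z) (level (Suc (Suc i))) + sum (slack t) (above (Suc (Suc i)))"
proof -
  have "sum (slack z) (below (Suc (Suc i))) = 0"
    using slack_eq_0_next_level[OF no_excess z] by (intro sum.neutral) (auto simp: below_def)
  moreover have "sum (slack z) (above (Suc (Suc i))) \<le> sum (slack t) (above (Suc (Suc i)))"
    using z t \<open>adj z t\<close>
    by (intro sum_mono slack_le_adj) (auto simp: above_def level_def level_dist_def)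
  ultimately show ?thesis using excess_split[of z "Suc (Suc i)"] by simp
qed

lemma slack_plus_above_le_excess:
  assumes t: "t \<in> level i" and z: "z \<in> below i"
  shows "slack t z + sum (slack t) (above i) \<le> excess t"
proof -
  have "0 \<le> slack t y" if "y \<in> Q" for y using slack_nonneg t that by (simp add: level_def)
  then have "slack t z \<le> sum (slack t) (below i)" "0 \<le> sum (slack t) (level i)"
    using z finite_parts by (auto intro!: member_le_sum sum_nonneg simp: below_def level_def)
  then show ?thesis using excess_split[of t i] by simp
qed

text \<open>A vertex \<open>w\<close> of level \<open>i + 1\<close> adjacent to \<open>t\<close> has slack at most 2 to each further vertex of the
  next level, and above that level no more slack than \<open>t\<close>. The count then leaves no slack between
  \<open>t\<close> and level \<open>i + 1\<close>.\<close>

lemma adj_if_level_collapse: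
  assumes no_excess: "level_excess i = 0"
    and count: "2 * int (card (level (Suc (Suc i)))) + level_excess (Suc (Suc i))
      = 2 + level_excess (Suc i)"
    and z: "z \<in> level (Suc i)" and t: "t \<in> level (Suc (Suc i))"
  shows "adj z t"
proof -
  let ?L = "level (Suc (Suc i))" and ?H = "above (Suc (Suc i))"
  have Q: "z \<in> Q" "t \<in> Q" "d b t = Suc (d b z)" using z t by (auto simp: level_def)
  obtain w where w: "w \<in> level (Suc i)" "adj w t" using adj_from_level_below[OF t] .
  have "slack w t = 0" using w t slack_upward_edge by (simp add: level_def)
  then have "sum (slack w) ?L = sum (slack w) (?L - {t})"
    using t finite_parts by (simp add: sum.remove[of ?L t])
  also have "\<dots> \<le> (\<Sum>y\<in>?L - {t}. 2)" using slack_le_2[OF no_excess w(1)] by (intro sum_mono) auto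
  also have "\<dots> = 2 * int (card ?L) - 2" using card_Suc_Diff1[OF finite_parts(1) t] by simp
  finally have "excess w \<le> 2 * int (card ?L) - 2 + sum (slack t) ?H"
    using excess_le_upward_edge[OF no_excess w(1) t w(2)] by simp
  moreover have "slack t z + sum (slack t) ?H \<le> excess t"
    using z by (intro slack_plus_above_le_excess t) (simp add: below_def level_def)
  ultimately have "slack t z \<le> 0"
    using count level_excess_eq[OF w(1)] level_excess_eq[OF t] by simp
  then have "slack t z = 0" using slack_nonneg Q by (simp add: order_antisym)
  then show ?thesis using adj_if_slack_eq_0[of t z] Q adj_commute by simp
qed

lemma level_collapse:
  assumes Suc_Suc_le: "Suc (Suc i) \<le> k" and no_excess: "level_excess i = 0"
    and count: "2 * int (card (level (Suc (Suc i)))) + level_excess (Suc (Suc i))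
      = 2 + level_excess (Suc i)"
  shows "card (level (Suc (Suc i))) = 1"
    and "level_excess (Suc i) = 0" and "level_excess (Suc (Suc i)) = 0"
proof -
  let ?L = "level (Suc (Suc i))" and ?H = "above (Suc (Suc i))"
  obtain t where t: "t \<in> ?L" using level_nonempty[OF Suc_Suc_le] by auto
  obtain z where z: "z \<in> level (Suc i)" "adj z t" using adj_from_level_below[OF t] .
  have "slack z y = 0" if "y \<in> ?L" for y
    using adj_if_level_collapse[OF no_excess count z(1) that] slack_upward_edge[of z y] z(1) that
    by (simp add: level_def)
  then have "excess z \<le> sum (slack t) ?H"
    using excess_le_upward_edge[OF no_excess z(1) t z(2)] by simp
  moreover have "0 \<le> slack t z" using slack_nonneg t z by (simp add: level_def)
  moreover have "slack t z + sum (slack t) ?H \<le> excess t"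
    using z by (intro slack_plus_above_le_excess t) (simp add: below_def level_def)
  ultimately have "level_excess (Suc i) \<le> level_excess (Suc (Suc i))"
    using level_excess_eq z(1) t by simp
  then show card_eq_1: "card ?L = 1" using count card_level_pos[OF Suc_Suc_le] by simp
  then show "level_excess (Suc (Suc i)) = 0" by (rule level_excess_singleton)
  then show "level_excess (Suc i) = 0" using count card_eq_1 by simp
qed

end

section \<open>The recursion for the level sizes\<close>

text \<open>Here \<open>q\<close> and \<open>s\<close> stand for the level sizes of two opposite intervals, \<open>X\<close> and \<open>Y\<close> for their
  excesses. Without excess each of \<open>q\<close> and \<open>s\<close> would determine the other by the two recurrences;
  the collapse hypotheses exclude positive excess.\<close>

locale level_recursion =
  fixes k m :: nat and q s :: "nat \<Rightarrow> nat" and X Y :: "nat \<Rightarrow> int"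
  assumes size_pos: "i \<le> k \<Longrightarrow> 1 \<le> q i" "i \<le> k \<Longrightarrow> 1 \<le> s i"
    and excess_nonneg: "i \<le> k \<Longrightarrow> 0 \<le> X i" "i \<le> k \<Longrightarrow> 0 \<le> Y i"
    and start: "q 0 = 1" "q 1 = 1" "s 0 = 1" "s 1 = m" "X 0 = 0" "X 1 = 0" "Y 0 = 0" "Y 1 = 0"
    and finish: "X k = 0" "X (k - 1) = 0" "Y k = 0"
    and q_rec: "i + 2 \<le> k \<Longrightarrow>
      2 * int (q i) - 2 * int (q (i + 1)) + 2 * int (q (i + 2)) + X i - 2 * X (i + 1) + X (i + 2)
        = 2 * int (s (i + 2))"
    and s_rec: "i + 2 \<le> k \<Longrightarrow>
      2 * int (s i) - 2 * int (s (i + 1)) + 2 * int (s (i + 2)) + Y i - 2 * Y (i + 1) + Y (i + 2)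
        = 2 * int (q i)"
    and q_collapse: "i + 2 \<le> k \<Longrightarrow> X i = 0 \<Longrightarrow> 2 * int (q (i + 2)) + X (i + 2) = 2 + X (i + 1) \<Longrightarrow>
      q (i + 2) = 1 \<and> X (i + 1) = 0 \<and> X (i + 2) = 0"
    and s_collapse: "i + 2 \<le> k \<Longrightarrow> Y i = 0 \<Longrightarrow> 2 * int (s (i + 2)) + Y (i + 2) = 2 + Y (i + 1) \<Longrightarrow>
      s (i + 2) = 1 \<and> Y (i + 1) = 0 \<and> Y (i + 2) = 0"
begin

definition exact :: "nat \<Rightarrow> nat \<Rightarrow> nat \<Rightarrow> bool" where
  "exact i qi si \<longleftrightarrow> q i = qi \<and> s i = si \<and> X i = 0 \<and> Y i = 0"

lemma s_collapse_offset_3: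
  assumes "i + 3 \<le> k" "exact i 1 1" "exact (i + 1) 1 m"
  shows "s (i + 3) = 1" "Y (i + 2) = 0" "Y (i + 3) = 0"
proof -
  have "2 * int (s (i + 2)) + Y (i + 2) = 2 * int m"
    using s_rec[of i] assms by (simp add: exact_def)
  then have "2 * int (s (i + 3)) + Y (i + 3) = 2 + Y (i + 2)"
    using s_rec[of "i + 1"] assms by (simp add: exact_def eval_nat_numeral)
  then show "s (i + 3) = 1" "Y (i + 2) = 0" "Y (i + 3) = 0"
    using s_collapse[of "i + 1"] assms by (simp_all add: exact_def eval_nat_numeral)
qed

lemma exact_offset_2:
  assumes i: "i + 2 \<le> k" and exact: "exact i 1 1" "exact (i + 1) 1 m"
  shows "exact (i + 2) m m"
proof -
  have q: "2 * int (q (i + 2)) + X (i + 2) = 2 * int (s (i + 2))"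
    using q_rec[OF i] exact by (simp add: exact_def)
  have Y: "Y (i + 2) = 0"
    using s_collapse_offset_3(2)[OF _ exact] finish i by (cases "i + 2 = k") auto
  then have s: "s (i + 2) = m" using s_rec[OF i] exact by (simp add: exact_def)
  consider "k = i + 2" | "k = i + 3" | (far) "i + 4 \<le> k" using i by linarith
  then have "X (i + 2) = 0"
  proof cases
    case far
    then have "2 * int (s (i + 4)) + Y (i + 4) = 2 * int (q (i + 2)) + 2 - 2 * int m"
      using s_rec[of "i + 2"] s_collapse_offset_3[OF _ exact] s Y by (simp add: eval_nat_numeral)
    moreover have "1 \<le> s (i + 4)" "0 \<le> Y (i + 4)" "0 \<le> X (i + 2)"
      using size_pos excess_nonneg far by auto
    ultimately show ?thesis using q s by simp
  qed (use finish in auto)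
  then show ?thesis using q s Y by (simp add: exact_def)
qed

lemma exact_offset_4_and_X_offset_3:
  assumes i: "i + 4 \<le> k" and exact: "exact i 1 1" "exact (i + 1) 1 m"
  shows "exact (i + 4) 1 1" "X (i + 3) = 0"
proof -
  have exact_2: "exact (i + 2) m m" using i by (intro exact_offset_2 exact) simp
  have s_3: "s (i + 3) = 1" "Y (i + 3) = 0" using i s_collapse_offset_3 exact by auto
  have q_3: "2 * int (q (i + 3)) + X (i + 3) = 2 * int m"
    using q_rec[of "i + 1"] i exact exact_2 s_3 by (simp add: exact_def eval_nat_numeral)
  have "2 * int (s (i + 4)) + Y (i + 4) = 2"
    using s_rec[of "i + 2"] i exact_2 s_3 by (simp add: exact_def eval_nat_numeral)
  then have s_4: "s (i + 4) = 1" "Y (i + 4) = 0"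
    using size_pos(2)[of "i + 4"] excess_nonneg(2)[of "i + 4"] i by linarith+
  have "2 * int (q (i + 4)) + X (i + 4) = 2 + X (i + 3)"
    using q_rec[of "i + 2"] i exact_2 s_4 q_3 by (simp add: exact_def eval_nat_numeral)
  then show "exact (i + 4) 1 1" "X (i + 3) = 0"
    using q_collapse[of "i + 2"] i exact_2 s_4 by (simp_all add: exact_def eval_nat_numeral)
qed

lemma exact_offset_3:
  assumes i: "i + 3 \<le> k" and exact: "exact i 1 1" "exact (i + 1) 1 m"
  shows "exact (i + 3) m 1"
proof -
  have exact_2: "exact (i + 2) m m" using i by (intro exact_offset_2 exact) simp
  have s: "s (i + 3) = 1" "Y (i + 3) = 0" using i s_collapse_offset_3 exact by auto
  have "X (i + 3) = 0"
    using exact_offset_4_and_X_offset_3(2)[OF _ exact] finish i by (cases "i + 3 = k") auto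
  then show ?thesis
    using q_rec[of "i + 1"] i exact exact_2 s by (simp add: exact_def eval_nat_numeral)
qed

lemma exact_offset_5:
  assumes i: "i + 5 \<le> k" and exact: "exact i 1 1" "exact (i + 1) 1 m"
  shows "exact (i + 5) 1 m"
proof -
  have exact_3: "exact (i + 3) m 1" and exact_4: "exact (i + 4) 1 1"
    using i exact_offset_3 exact_offset_4_and_X_offset_3(1) exact by auto
  have "2 * int (q (i + 5)) + X (i + 5) = 2 * int (s (i + 5)) + 2 - 2 * int m"
    using q_rec[of "i + 3"] i exact_3 exact_4 by (simp add: exact_def eval_nat_numeral)
  moreover have "2 * int (s (i + 5)) + Y (i + 5) = 2 * int m"
    using s_rec[of "i + 3"] i exact_3 exact_4 by (simp add: exact_def eval_nat_numeral)
  moreover have "1 \<le> q (i + 5)" "0 \<le> X (i + 5)" "0 \<le> Y (i + 5)"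
    using size_pos excess_nonneg i by auto
  ultimately show ?thesis by (simp add: exact_def)
qed

lemma exact_multiple_of_4:
  "(4 * t \<le> k \<longrightarrow> exact (4 * t) 1 1) \<and> (4 * t + 1 \<le> k \<longrightarrow> exact (4 * t + 1) 1 m)"
proof (induction t)
  case 0
  then show ?case using start by (simp add: exact_def)
next
  case (Suc t)
  then show ?case
    using exact_offset_4_and_X_offset_3(1)[of "4 * t"] exact_offset_5[of "4 * t"]
    by (simp add: add.commute)
qed

lemma exact_W_layer:
  assumes "i \<le> k"
  shows "exact i (W_layer m (i + 3)) (W_layer m i)"
proof -
  define t where "t = i div 4"
  have i: "i = 4 * t + i mod 4" by (simp add: t_def)
  have "i mod 4 < 4" by simp
  then consider (mod_0) "i = 4 * t" | (mod_1) "i = 4 * t + 1" | (mod_2) "i = 4 * t + 2"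
    | (mod_3) "i = 4 * t + 3"
    using i by linarith
  then show ?thesis
  proof cases
    case mod_0
    then show ?thesis using exact_multiple_of_4[of t] assms by (simp add: W_layer_def cong_def)
  next
    case mod_1
    then show ?thesis using exact_multiple_of_4[of t] assms
      by (simp add: W_layer_def cong_def mod_Suc)
  next
    case mod_2
    then show ?thesis using exact_offset_2[of "4 * t"] exact_multiple_of_4[of t] assms
      by (simp add: W_layer_def cong_def mod_Suc)
  next
    case mod_3
    then show ?thesis using exact_offset_3[of "4 * t"] exact_multiple_of_4[of t] assms
      by (simp add: W_layer_def cong_def mod_Suc)
  qed
qed

end

section \<open>The two sides of the cut\<close>

text \<open>The last assumption makes \<open>D\<close> the smaller side: it says \<open>|D| \<le> |V - {a, b} - D|\<close>.\<close>

locale two_cut_side = balanced_metric +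
  fixes a b :: 'a and D :: "'a set"
  assumes d_a_b: "d a b = 3"
    and separates_D: "separates {a, b} D"
    and D_nonempty: "D \<noteq> {}"
    and D_small: "2 * card D + 2 \<le> card V"
begin

abbreviation A :: "'a set" where "A \<equiv> nbrs_in D a"
abbreviation B :: "'a set" where "B \<equiv> nbrs_in D b"
abbreviation Q :: "'a set" where "Q \<equiv> closer b a - D"
abbreviation R :: "'a set" where "R \<equiv> closer a b - D"

lemma cut_V: "a \<in> V" "b \<in> V" "a \<notin> D" "b \<notin> D" "D \<subseteq> V"
  using separates_D by (auto simp: separates_def)

lemma D_V: "u \<in> D \<Longrightarrow> u \<in> V"
  using cut_V by blast

lemma a_neq_b: "a \<noteq> b"
  using d_a_b cut_V by auto

lemma guards_D: "guards {a, b} D"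
  using separates_D cut_V by (intro separates_imp_guards) simp_all

lemma d_D:
  assumes "u \<in> D" "z \<in> V - D"
  shows "d u z = min (d a u + d a z) (d b u + d b z)"
proof -
  have "\<exists>s\<in>{a, b}. d u z = d s u + d s z" using guards_D assms by (auto simp: guards_def)
  moreover have "d u z \<le> d a u + d a z" "d u z \<le> d b u + d b z"
    using d_triangle[of u a z] d_triangle[of u b z] d_commute[of u a] d_commute[of u b]
      assms cut_V by auto
  ultimately show ?thesis by auto
qed

lemma d_nbr_a:
  assumes u: "u \<in> A"
  shows "d a u = 1" "d b u = 2"
proof -
  have uD: "u \<in> D" "adj a u" using u by (auto simp: nbrs_in_def)
  then show d_a_u: "d a u = 1" by (simp add: d_adj)
  have "d b u \<noteq> 4"
  proof
    assume "d b u = 4"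
    then have "card V \<le> 2 * card D"
      using uD d_a_u d_a_b d_commute[of a b] cut_V adj_commute[of a u]
      by (intro card_V_le_guarded[OF guards_D uD(1)]) auto
    then show False using D_small by simp
  qed
  then show "d b u = 2"
    using d_adj_cases[OF uD(2) cut_V(2)] d_a_b d_commute[of a b] by auto
qed

lemma other_side_nonempty: "V - {a, b} - D \<noteq> {}"
proof
  assume "V - {a, b} - D = {}"
  then have "V = {a, b} \<union> D" using cut_V by blast
  moreover have "card ({a, b} \<union> D) \<le> card {a, b} + card D" by (rule card_Un_le)
  moreover have "1 \<le> card D"
    using D_nonempty cut_V finite_V by (simp add: Suc_le_eq card_gt_0_iff finite_subset)
  ultimately show False using D_small a_neq_b by simp
qed

end

sublocale two_cut_side \<subseteq> swap: two_cut_side V adj d b a D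
  using d_a_b d_commute[of a b] separates_D D_nonempty D_small
  by unfold_locales (simp_all add: insert_commute)

context two_cut_side
begin

lemma d_sum_D:
  assumes "u \<in> D"
  shows "d a u + d b u = 3"
proof (rule ccontr)
  assume u: "d a u + d b u \<noteq> 3"
  define C where "C = {v \<in> D. d a v + d b v \<noteq> 3}"
  have "separates {a, b} C"
    unfolding separates_def
  proof (intro conjI ballI allI impI)
    fix v w assume v: "v \<in> C" and vw: "adj v w"
    then have "w \<in> D \<union> {a, b}" using separates_D by (auto simp: C_def separates_def)
    moreover have "d a v + d b v = d a w + d b w" if "w \<in> D"
      using d_sum_edge[OF guards_D] v vw that D_small by (simp add: C_def)
    ultimately show "w \<in> C \<union> {a, b}" using v by (auto simp: C_def)
  qed (use cut_V in \<open>auto simp: C_def\<close>)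
  moreover have "C \<noteq> {}" using u assms by (auto simp: C_def)
  ultimately obtain v where "v \<in> C" "adj a v"
    using nbrs_in_two_cut_nonempty(1)[of a b C] a_neq_b by (auto simp: nbrs_in_def)
  then show False using d_nbr_a[of v] by (simp add: C_def nbrs_in_def)
qed

lemma D_eq: "D = A \<union> B" "A \<inter> B = {}"
proof -
  have "u \<in> A \<union> B" if "u \<in> D" for u
  proof -
    have "d a u \<noteq> 0" "d b u \<noteq> 0" using d_eq_0_iff that cut_V by auto
    then have "d a u = 1 \<or> d b u = 1" using d_sum_D[OF that] by linarith
    then show ?thesis using d_eq_1_iff that cut_V by (auto simp: nbrs_in_def)
  qed
  then show "D = A \<union> B" by (auto simp: nbrs_in_def)
  show "A \<inter> B = {}" using d_nbr_a swap.d_nbr_a by fastforce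
qed

lemma nbrs_nonempty: "A \<noteq> {}" "B \<noteq> {}"
  using nbrs_in_two_cut_nonempty[OF separates_D D_nonempty a_neq_b] by auto

lemma odd_d_sum:
  assumes "z \<in> V"
  shows "odd (d a z + d b z)"
  using even_d_triangle[of a b z] d_a_b assms cut_V d_commute[of a z] d_commute[of b z] by simp

lemma V_eq: "V = A \<union> B \<union> Q \<union> R"
proof -
  have "z \<in> closer a b \<union> closer b a" if "z \<in> V" for z
  proof -
    have "d a z \<noteq> d b z" using odd_d_sum[OF that] by auto
    then show ?thesis using that by (auto simp: closer_def)
  qed
  moreover have "closer a b \<subseteq> V" "closer b a \<subseteq> V" by (auto simp: closer_def)
  ultimately show ?thesis using D_eq cut_V by blast
qed

lemma parts_disjoint:
  "A \<inter> Q = {}" "A \<inter> R = {}" "B \<inter> Q = {}" "B \<inter> R = {}" "Q \<inter> R = {}"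
  by (auto simp: nbrs_in_def closer_def)

lemma finite_sides: "finite A" "finite B" "finite Q" "finite R"
proof -
  have "finite (A \<union> B \<union> Q \<union> R)" using finite_V V_eq by metis
  then show "finite A" "finite B" "finite Q" "finite R" by simp_all
qed

lemma cut_in_sides: "a \<in> R" "b \<in> Q"
  using cut_V d_a_b d_commute[of a b] by (auto simp: closer_def)

lemma card_V: "card V = card A + card B + card Q + card R"
proof -
  have "card V = card (A \<union> B \<union> Q \<union> R)" by (rule arg_cong[OF V_eq])
  also have "\<dots> = card A + card B + card Q + card R"
    using D_eq(2) parts_disjoint finite_sides by (simp add: card_Un_disjoint Int_Un_distrib2)
  finally show ?thesis .
qed

lemma adj_A:
  assumes u: "u \<in> A" and w: "adj u w"
  shows "w = a \<or> w \<in> B"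
proof -
  from assms have "w \<in> D \<union> {a, b}" using separates_D by (auto simp: nbrs_in_def separates_def)
  moreover have "w \<noteq> b" using d_adj[OF w] d_nbr_a[OF u] d_commute[of u b] by auto
  moreover have "w \<notin> A" using d_adj_neq[OF w cut_V(1)] d_nbr_a[OF u] d_nbr_a[of w] by auto
  ultimately show ?thesis using D_eq by blast
qed

lemma crossing_edge_d:
  assumes z: "z \<in> Q" and w: "w \<in> R" and zw: "adj z w"
  shows "d a z = d b z + 1" "d b w = d a w + 1" "d b z = d a w"
  using d_adj_cases[OF zw cut_V(1)] d_adj_cases[OF zw cut_V(2)] z w
  by (auto simp: closer_def)

lemma nbr_outside_D:
  assumes "v \<in> V - {a, b} - D" "adj a v"
  shows "v \<in> R"
proof -
  have "d a v = 1" "d b v \<noteq> 0" using d_adj[OF assms(2)] d_eq_0_iff[of b v] assms(1) cut_V by auto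
  moreover have "3 \<le> d a v + d b v"
    using d_triangle[of a v b] d_a_b assms(1) cut_V d_commute[of b v] by auto
  ultimately show ?thesis using assms(1) by (auto simp: closer_def)
qed

lemma crossing_edge_exists: "\<exists>z\<in>Q. \<exists>w\<in>R. adj z w"
proof (rule ccontr)
  assume no_edge: "\<not> ?thesis"
  have "separates {a} (R - {a})"
    unfolding separates_def
  proof (intro conjI ballI allI impI)
    fix u w assume u: "u \<in> R - {a}" and uw: "adj u w"
    have "w \<notin> D"
    proof
      assume "w \<in> D"
      moreover have "u \<noteq> b" using u cut_in_sides parts_disjoint by auto
      ultimately show False using separates_D uw u adj_commute[of u w] by (auto simp: separates_def)
    qed
    then have "w \<in> Q \<union> R" using adj_V[OF uw] V_eq D_eq by blast
    then show "w \<in> R - {a} \<union> {a}" using no_edge u uw adj_commute[of u w] by auto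
  qed (use cut_V in \<open>auto simp: closer_def\<close>)
  moreover obtain v where "v \<in> V - {a, b} - D" "adj a v"
    using nbrs_in_two_cut_nonempty(1)[OF separates_complement[OF separates_D]]
      other_side_nonempty a_neq_b
    by (auto simp: nbrs_in_def)
  then have "R - {a} \<noteq> {}" using nbr_outside_D by blast
  ultimately have "R - {a} = V - {a}" by (rule no_cut_vertex)
  moreover have "b \<in> V - {a}" "b \<notin> R" using cut_V a_neq_b cut_in_sides(2) parts_disjoint by auto
  ultimately show False by blast
qed

lemma closer_nbr_a_outside_iff:
  assumes u: "u \<in> A" and z: "z \<in> V - D"
  shows "d u z < d a z \<longleftrightarrow> z \<in> behind b a"
proof -
  have "d a z \<le> d b z + 3"
    using d_triangle[of a b z] d_a_b z cut_V by simp
  moreover have "d a z \<noteq> d b z + 2" "d a z \<noteq> d b z" using odd_d_sum[of z] z by auto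
  ultimately show ?thesis
    using d_D[of u z] u z d_nbr_a[OF u] d_a_b by (auto simp: nbrs_in_def behind_def)
qed

lemma behind_subset: "behind b a \<subseteq> Q"
proof
  fix z assume "z \<in> behind b a"
  then have z: "z \<in> V" "d a z = 3 + d b z" by (auto simp: behind_def d_a_b)
  moreover have "z \<noteq> a" using z cut_V by auto
  then have "d a z \<noteq> 0" using d_eq_0_iff cut_V z by simp
  moreover have "z \<notin> D" using d_sum_D[of z] z d_eq_0_iff[of b z] cut_V by auto
  ultimately show "z \<in> Q" by (simp add: closer_def)
qed

lemma closer_nbr_a:
  assumes u: "u \<in> A"
  shows "closer u a = {u} \<union> nbrs_in B u \<union> behind b a" (is "_ = ?C")
proof -
  have uD: "u \<in> V" "u \<in> D" using u D_V by (auto simp: nbrs_in_def)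
  have "d u z < d a z \<longleftrightarrow> z \<in> ?C" if z: "z \<in> V" for z
  proof (cases "z \<in> D")
    case False
    then have "z \<noteq> u" "z \<notin> nbrs_in B u" using uD by (auto simp: nbrs_in_def)
    then show ?thesis using closer_nbr_a_outside_iff[OF u, of z] False z by simp
  next
    case True
    then have "z \<notin> behind b a" using behind_subset by blast
    consider (self) "z = u" | (A) "z \<in> A" "z \<noteq> u" | (B) "z \<in> B" using True D_eq by blast
    then show ?thesis
    proof cases
      case self
      then show ?thesis using uD d_nbr_a[OF u] by simp
    next
      case A
      then have "d u z \<noteq> 0" "z \<notin> B" using d_eq_0_iff uD z D_eq by auto
      then show ?thesis using A d_nbr_a[of z] \<open>z \<notin> behind b a\<close> by (auto simp: nbrs_in_def)
    next
      case B
      then have "z \<noteq> u" using u D_eq(2) by blast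
      then have "d u z < d a z \<longleftrightarrow> d u z = 1"
        using swap.d_nbr_a[OF B] d_eq_0_iff[of u z] uD z by auto
      then show ?thesis
        using d_eq_1_iff[of u z] B uD z \<open>z \<noteq> u\<close> \<open>z \<notin> behind b a\<close> by (auto simp: nbrs_in_def)
    qed
  qed
  moreover have "?C \<subseteq> V" using uD D_V by (auto simp: nbrs_in_def behind_def)
  ultimately show ?thesis by (auto simp: closer_def)
qed

lemma card_V_nbr_a:
  assumes u: "u \<in> A"
  shows "card V = 2 * (1 + card (nbrs_in B u) + card (behind b a))"
proof -
  have "u \<notin> B" "u \<in> D" using u D_eq(2) by (auto simp: nbrs_in_def)
  have "finite (nbrs_in B u)" "finite (behind b a)"
    using finite_sides(2) finite_subset[OF behind_subset finite_sides(3)]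
    by (simp_all add: nbrs_in_def[of B])
  moreover have "{u} \<inter> nbrs_in B u = {}" using \<open>u \<notin> B\<close> by (auto simp: nbrs_in_def)
  moreover have "({u} \<union> nbrs_in B u) \<inter> behind b a = {}"
    using \<open>u \<in> D\<close> behind_subset by (auto simp: nbrs_in_def)
  ultimately have "card (closer u a) = 1 + card (nbrs_in B u) + card (behind b a)"
    unfolding closer_nbr_a[OF u] by (simp add: card_Un_disjoint)
  moreover have "adj u a" using u adj_commute by (auto simp: nbrs_in_def)
  ultimately show ?thesis using card_closer by metis
qed

lemma not_behind_nonempty: "Q - behind b a \<noteq> {}"
proof -
  obtain z w where "z \<in> Q" "w \<in> R" "adj z w" using crossing_edge_exists by blast
  then have "z \<in> Q - behind b a" using crossing_edge_d(1) d_a_b by (auto simp: behind_def)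
  then show ?thesis by blast
qed

lemma card_Q: "card Q = card (Q - behind b a) + card (behind b a)" "1 \<le> card (Q - behind b a)"
proof -
  show "card Q = card (Q - behind b a) + card (behind b a)"
    using card_Int_Diff[of Q "behind b a"] behind_subset finite_sides by (simp add: inf_absorb2)
  show "1 \<le> card (Q - behind b a)"
    using not_behind_nonempty finite_sides by (simp add: Suc_le_eq card_gt_0_iff)
qed

end

context two_cut_side
begin

text \<open>Adding the counts for the edges at \<open>a\<close> and at \<open>b\<close> leaves no room for a non-edge between \<open>A\<close>
  and \<open>B\<close> or for a second vertex of \<open>Q\<close> that is not behind \<open>b\<close>.\<close>

lemma full_nbrs_and_card_not_behind:
  assumes u: "u \<in> A" and v: "v \<in> B"
  shows "card (nbrs_in B u) = card B" "card (Q - behind b a) = 1"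
proof -
  have "card (nbrs_in B u) \<le> card B" "card (nbrs_in A v) \<le> card A"
    using finite_sides by (auto simp: nbrs_in_def intro: card_mono)
  moreover have "card A + card B + card (Q - behind b a) + card (R - behind a b)
      = 2 + card (nbrs_in B u) + card (nbrs_in A v)"
    using card_V card_V_nbr_a[OF u] swap.card_V_nbr_a[OF v] card_Q(1) swap.card_Q(1)
    by presburger
  ultimately show "card (nbrs_in B u) = card B" "card (Q - behind b a) = 1"
    using card_Q(2) swap.card_Q(2) by linarith+
qed

lemma adj_A_B:
  assumes "u \<in> A" "v \<in> B"
  shows "adj u v"
proof -
  have "nbrs_in B u = B"
    using full_nbrs_and_card_not_behind(1)[OF assms] finite_sides
    by (intro card_subset_eq) (auto simp: nbrs_in_def)
  then show ?thesis using assms(2) unfolding nbrs_in_def[of B] by blast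
qed

lemma card_not_behind: "card (Q - behind b a) = 1"
  using full_nbrs_and_card_not_behind(2) nbrs_nonempty by blast

lemma closer_A_B:
  assumes u: "u \<in> A" and v: "v \<in> B"
  shows "closer u v = {u} \<union> (B - {v}) \<union> R" (is "_ = ?C")
proof -
  have uv: "u \<in> D" "v \<in> D" "u \<noteq> v" using u v D_eq by auto
  have adj: "adj u v" using u v by (rule adj_A_B)
  have "d u z < d v z \<longleftrightarrow> z \<in> ?C" if z: "z \<in> V" for z
  proof -
    consider (u) "z = u" | (v) "z = v" | (A) "z \<in> A" "z \<noteq> u" | (B) "z \<in> B" "z \<noteq> v"
      | (outside) "z \<in> Q \<union> R"
      using z V_eq by blast
    then show ?thesis
    proof cases
      case u
      then show ?thesis using d_eq_0_iff[of v u] uv D_V z by auto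
    next
      case v
      then show ?thesis using uv z by auto
    next
      case A
      then have "d v z = 1" "d u z \<noteq> 0" "z \<notin> B" "z \<in> D"
        using adj_A_B[of z v] v d_adj adj_commute d_eq_0_iff[of u z] uv D_V z D_eq(2)
        by (auto simp: nbrs_in_def)
      then show ?thesis using A by auto
    next
      case B
      then have "d u z = 1" "d v z \<noteq> 0" using adj_A_B u d_adj d_eq_0_iff uv D_V z by auto
      moreover have "d v z \<noteq> d u z"
        using d_adj_neq[OF adj z] d_commute[of u z] d_commute[of v z] by simp
      ultimately show ?thesis using B by auto
    next
      case outside
      then have "z \<in> V - D" using z by auto
      then have "d u z < d v z \<longleftrightarrow> z \<in> R"
        using outside d_D[of u z] d_D[of v z] uv d_nbr_a[OF u] swap.d_nbr_a[OF v]
        by (auto simp: closer_def)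
      then show ?thesis using uv v \<open>z \<in> V - D\<close> by (auto simp: nbrs_in_def)
    qed
  qed
  moreover have "?C \<subseteq> V" using uv D_V by (auto simp: nbrs_in_def closer_def)
  ultimately show ?thesis by (auto simp: closer_def)
qed

lemma card_V_B_R: "card V = 2 * (card B + card R)"
proof -
  obtain u v where uv: "u \<in> A" "v \<in> B" using nbrs_nonempty by blast
  have "u \<notin> B" "u \<notin> R" using uv D_eq(2) parts_disjoint by blast+
  then have "card (closer u v) = 1 + card (B - {v}) + card R"
    unfolding closer_A_B[OF uv] using finite_sides parts_disjoint
    by (subst card_Un_disjoint) auto
  also have "1 + card (B - {v}) = card B" using card_Suc_Diff1[of B v] finite_sides uv by simp
  finally show ?thesis using card_closer[OF adj_A_B[OF uv]] by simp
qed

lemma card_sides: "card R = card Q" "card B = card A"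
proof -
  obtain u v where uv: "u \<in> A" "v \<in> B" using nbrs_nonempty by blast
  have "card V = 2 * (card B + card Q)"
    using card_V_nbr_a[OF uv(1)] full_nbrs_and_card_not_behind[OF uv] card_Q(1) by simp
  then show "card R = card Q" "card B = card A" using card_V_B_R card_V by simp_all
qed

end

section \<open>The two intervals on the other side of the cut\<close>

lemma W_layer_eq_if: "W_layer m i = (if i mod 4 = 0 \<or> i mod 4 = 3 then 1 else m)"
  by (simp add: W_layer_def cong_def)

locale two_cut_crossing = two_cut_side +
  fixes x y :: 'a and k m :: nat
  assumes x_in_Q: "x \<in> Q" and y_in_R: "y \<in> R" and adj_x_y: "adj x y"
    and d_b_x: "d b x = k" and card_A: "card A = m"
begin

lemma d_ends: "d a x = k + 1" "d b y = k + 1" "d a y = k" "d x y = 1"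
  using crossing_edge_d[OF x_in_Q y_in_R adj_x_y] d_b_x d_adj[OF adj_x_y] by auto

lemma not_behind_eq: "Q - behind b a = {x}"
proof -
  have "x \<in> Q - behind b a" using x_in_Q d_ends d_b_x d_a_b by (simp add: behind_def)
  then show ?thesis using card_not_behind by (metis card_1_singletonE singletonD)
qed

end

sublocale two_cut_crossing \<subseteq> swap: two_cut_crossing V adj d b a D y x k m
proof unfold_locales
  show "y \<in> R" "x \<in> Q" "adj y x" using x_in_Q y_in_R adj_x_y adj_commute by auto
  show "d a y = k" by (rule d_ends)
  show "card B = m" using card_sides card_A by simp
qed

context two_cut_crossing
begin

lemma ends_V: "x \<in> V" "y \<in> V"
  using adj_V[OF adj_x_y] by auto

lemma Q_V: "z \<in> Q \<Longrightarrow> z \<in> V"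
  by (simp add: closer_def)

lemma x_neq_b: "x \<noteq> b"
  using d_ends(1) d_b_x d_a_b cut_V by auto

lemma k_pos: "1 \<le> k"
  using d_b_x x_neq_b d_eq_0_iff[of b x] cut_V ends_V by simp

lemma m_pos: "1 \<le> m"
  using card_A nbrs_nonempty(1) finite_sides by (simp add: Suc_le_eq card_gt_0_iff flip: card_A)

lemma card_V_Q: "card V = 2 * (m + card Q)"
  using card_V card_sides card_A by simp

lemma crossing_edge_unique:
  assumes "z \<in> Q" "w \<in> R" "adj z w"
  shows "z = x \<and> w = y"
proof -
  have "z \<notin> behind b a" "w \<notin> behind a b"
    using crossing_edge_d[OF assms] d_a_b d_commute[of a b] by (auto simp: behind_def)
  then show ?thesis using assms not_behind_eq swap.not_behind_eq by blast
qed

lemma adj_Q: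
  assumes "z \<in> Q" "adj z w"
  shows "w \<in> Q \<or> z = b \<and> w \<in> B \<or> z = x \<and> w = y"
proof (cases "w \<in> D")
  case True
  then have "z = b" using separates_D assms adj_commute[of z w] cut_in_sides(1) parts_disjoint(5)
    by (auto simp: separates_def)
  then show ?thesis using True assms by (simp add: nbrs_in_def)
next
  case False
  then have "w \<in> Q \<union> R" using adj_V[OF assms(2)] V_eq D_eq by blast
  then show ?thesis using crossing_edge_unique assms by blast
qed

lemma guards_Q: "guards {b, x} Q"
proof (rule separates_imp_guards)
  show "separates {b, x} (Q - {b, x})"
    unfolding separates_def using adj_Q cut_V ends_V Q_V by blast
  show "Q \<subseteq> V" using Q_V by blast
qed

lemma d_sum_Q:
  assumes "z \<in> Q"
  shows "d b z + d x z = k"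
proof (rule ccontr)
  assume z: "d b z + d x z \<noteq> k"
  define C where "C = {z \<in> Q. d b z + d x z \<noteq> k}"
  have cut_notin_C: "b \<notin> C" "x \<notin> C"
    using d_b_x d_commute[of b x] cut_V ends_V by (auto simp: C_def)
  have Q_small: "2 * card Q < card V" using card_V_Q m_pos by simp
  have "separates {} C"
    unfolding separates_def
  proof (intro conjI ballI allI impI)
    fix v w assume v: "v \<in> C" and vw: "adj v w"
    have vQ: "v \<in> Q" using v by (simp add: C_def)
    then have wQ: "w \<in> Q" using adj_Q[OF _ vw] v cut_notin_C by blast
    have "d b v + d x v = d b w + d x w" by (rule d_sum_edge[OF guards_Q Q_small vQ wQ vw])
    then show "w \<in> C \<union> {}" using v wQ by (simp add: C_def)
  qed (use Q_V in \<open>auto simp: C_def\<close>)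
  moreover have "z \<in> C" using z assms by (simp add: C_def)
  ultimately show False using separates_empty_imp cut_notin_C cut_V by blast
qed

end

context two_cut_crossing
begin

lemma Q_eq_interval: "Q = {z \<in> V. d b z + d x z = k}"
proof -
  have "z \<in> Q" if z: "z \<in> V" "d b z + d x z = k" for z
  proof (rule ccontr)
    assume "z \<notin> Q"
    then consider (D) "z \<in> D" | (R) "z \<in> R" using z(1) V_eq D_eq by blast
    then show False
    proof cases
      case D
      then have "d b z \<noteq> 0" using d_eq_0_iff cut_V z by auto
      moreover have "d x z = min (d a z + (k + 1)) (d b z + k)"
        using d_D[OF D, of x] x_in_Q ends_V d_ends d_b_x d_commute[of x z] by simp
      ultimately show False using z(2) by simp
    next
      case R
      have "x \<in> V - R" using ends_V x_in_Q parts_disjoint by blast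
      then obtain s where s: "s \<in> {a, y}" "d z x = d s z + d s x"
        using swap.guards_Q R unfolding guards_def by blast
      have "d b y \<le> d b z + d y z"
        using d_triangle[of b z y] d_commute[of y z] z ends_V cut_V by simp
      then show False using s d_ends z(2) d_commute[of x z] d_commute[of x y] by auto
    qed
  qed
  then show ?thesis using d_sum_Q Q_V by blast
qed

end

sublocale two_cut_crossing \<subseteq> Q: interval V adj d b x k "closer b a - D"
  using cut_V ends_V d_b_x Q_eq_interval finite_sides by unfold_locales

context two_cut_crossing
begin

text \<open>\<open>swap.Q\<close> is the interval \<open>R\<close> with its levels numbered from \<open>a\<close>. The recursion needs them
  numbered from \<open>y\<close>, the vertex opposite to \<open>b\<close>.\<close>

abbreviation R_level :: "nat \<Rightarrow> 'a set" where "R_level \<equiv> swap.Q.rev.level"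
abbreviation R_above :: "nat \<Rightarrow> 'a set" where "R_above \<equiv> swap.Q.rev.above"

lemma d_Q_D:
  assumes "z \<in> Q" "u \<in> D"
  shows "d z u = d b z + d b u"
proof -
  have "d a u \<le> d b u + 1" "d b u \<le> d a u + 1"
    using assms(2) D_eq(1) d_nbr_a[of u] swap.d_nbr_a[of u] by fastforce+
  moreover have "d b z < d a z" using assms(1) by (simp add: closer_def)
  ultimately show ?thesis
    using d_D[of u z] assms Q_V d_commute[of z u] by simp
qed

lemma d_Q_R:
  assumes z: "z \<in> Q" and p: "p \<in> R"
  shows "d z p = min (d b z + 3 + d a p) (d x z + 1 + d y p)"
proof -
  have V: "z \<in> V" "p \<in> V - Q" using z p Q_V swap.Q_V parts_disjoint by blast+
  have "d x a = k + 1" "d y b = k + 1" using d_ends d_commute[of x a] d_commute[of y b] by simp_all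
  note ends = this d_ends d_a_b d_commute[of a b] d_commute[of x y]
  have sums: "d b z + d x z = k" "d a p + d y p = k"
    using d_sum_Q[OF z] swap.d_sum_Q[OF p] by auto
  obtain s where s: "s \<in> {b, x}" "d z p = d s z + d s p"
    using guards_Q z V unfolding guards_def by blast
  moreover have "s \<in> V - R" using s(1) cut_V ends_V cut_in_sides x_in_Q parts_disjoint by blast
  then obtain t where t: "t \<in> {a, y}" "d p s = d t p + d t s"
    using swap.guards_Q p unfolding guards_def by blast
  ultimately have "d z p = d s z + d t s + d t p" using d_commute[of s p] by simp
  moreover have "d z p \<le> d b z + 3 + d a p" "d z p \<le> d x z + 1 + d y p"
    using d_triangle[of z b p] d_triangle[of b a p] d_triangle[of z x p] d_triangle[of x y p]
      d_commute[of z b] d_commute[of z x] ends V cut_V ends_V by auto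
  ultimately show ?thesis using s(1) t(1) ends sums by auto
qed

lemma closer_upward_edge:
  assumes zw: "z \<in> Q" "w \<in> Q" "adj z w" "d b w = Suc (d b z)"
  shows "closer w z = {p \<in> Q. d w p < d z p} \<union> (R - R_above (Suc (d b z)))" (is "_ = ?C")
proof -
  have "d w p < d z p \<longleftrightarrow> p \<in> ?C" if p: "p \<in> V" for p
  proof -
    consider (D) "p \<in> D" | (Q) "p \<in> Q" | (R) "p \<in> R" using p V_eq D_eq by blast
    then show ?thesis
    proof cases
      case D
      then show ?thesis using d_Q_D[OF zw(1) D] d_Q_D[OF zw(2) D] zw(4) by simp
    next
      case Q
      then have "p \<notin> R" using parts_disjoint by blast
      then show ?thesis using Q by simp
    next
      case R
      then have "p \<notin> Q" using parts_disjoint by blast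
      have "d w p < d z p \<longleftrightarrow> d y p \<le> Suc (d b z)"
        using d_Q_R[OF zw(1) R] d_Q_R[OF zw(2) R] zw(4)
          d_sum_Q[OF zw(1)] d_sum_Q[OF zw(2)] swap.d_sum_Q[OF R] by auto
      then show ?thesis using R \<open>p \<notin> Q\<close> by (simp add: swap.Q.rev.above_def not_less)
    qed
  qed
  moreover have "?C \<subseteq> V" using Q_V swap.Q_V by blast
  ultimately show ?thesis by (auto simp: closer_def)
qed

lemma card_closer_upward_edge:
  assumes zw: "z \<in> Q" "w \<in> Q" "adj z w" "d b w = Suc (d b z)"
  shows "card {p \<in> Q. d w p < d z p} = m + card (R_above (Suc (d b z)))"
proof -
  let ?H = "R_above (Suc (d b z))"
  have H: "?H \<subseteq> R" by (auto simp: swap.Q.rev.above_def)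
  have "finite {p \<in> Q. d w p < d z p}" by (rule finite_subset[OF _ finite_sides(3)]) blast
  then have "card (closer w z) = card {p \<in> Q. d w p < d z p} + card (R - ?H)"
    unfolding closer_upward_edge[OF zw] using finite_sides(4) parts_disjoint(5)
    by (intro card_Un_disjoint) auto
  moreover have "card R = card ?H + card (R - ?H)"
    using card_Int_Diff[of R ?H] finite_sides H by (simp add: inf_absorb2)
  moreover have "2 * card (closer w z) = card V" using zw(3) adj_commute by (intro card_closer) simp
  ultimately show ?thesis using card_V_Q card_sides by simp
qed

lemma excess_upward_edge:
  assumes zw: "z \<in> Q" "w \<in> Q" "adj z w" "d b w = Suc (d b z)"
  shows "Q.excess z - Q.excess w = 2 * int m + 2 * int (card (R_above (Suc (d b z))))
    - 2 * int (card (Q.level (d b z))) - 2 * int (card (Q.above (Suc (d b z))))"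
  using Q.excess_diff_upward_edge[OF zw] card_closer_upward_edge[OF zw] by simp

lemma excess_cong_Q:
  assumes "z \<in> Q" "w \<in> Q" "d b z = d b w"
  shows "Q.excess z = Q.excess w"
  using assms
proof (induction "d b z" arbitrary: z w)
  case 0
  then have "z = b" "w = b" using d_eq_0_iff[of b z] d_eq_0_iff[of b w] Q_V cut_V by auto
  then show ?case by simp
next
  case (Suc i)
  then have "z \<in> Q.level (Suc i)" "w \<in> Q.level (Suc i)" by (auto simp: Q.level_def)
  then obtain z' w' where "z' \<in> Q.level i" "adj z' z" "w' \<in> Q.level i" "adj w' w"
    by (elim Q.adj_from_level_below)
  then have z': "z' \<in> Q" "adj z' z" "d b z' = i" and w': "w' \<in> Q" "adj w' w" "d b w' = i"
    by (auto simp: Q.level_def)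
  then have "Q.excess z' = Q.excess w'" using Suc.hyps(1) by simp
  then show ?case
    using excess_upward_edge[OF z'(1) Suc.prems(1) z'(2)]
      excess_upward_edge[OF w'(1) Suc.prems(2) w'(2)] Suc.hyps(2) Suc.prems(3) z' w' by simp
qed

end

sublocale two_cut_crossing \<subseteq> Q: regular_interval V adj d b x k "closer b a - D"
  by unfold_locales (rule excess_cong_Q)

context two_cut_crossing
begin

abbreviation R_level_excess :: "nat \<Rightarrow> int" where "R_level_excess \<equiv> swap.Q.rev.level_excess"

lemma level_excess_diff:
  assumes "i < k"
  shows "Q.level_excess i - Q.level_excess (Suc i) =
    2 * int m + 2 * int (card (R_above (Suc i)))
      - 2 * int (card (Q.level i)) - 2 * int (card (Q.above (Suc i)))"
proof -
  obtain w where w: "w \<in> Q.level (Suc i)" using Q.level_nonempty[of "Suc i"] assms by auto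
  obtain z where z: "z \<in> Q.level i" "adj z w" using Q.adj_from_level_below[OF w] .
  then show ?thesis
    using excess_upward_edge[of z w] Q.level_excess_eq[OF w] Q.level_excess_eq[OF z(1)] w
    by (simp add: Q.level_def)
qed

lemma level_excess_second_diff:
  assumes "i + 2 \<le> k"
  shows "2 * int (card (Q.level i)) - 2 * int (card (Q.level (i + 1)))
      + 2 * int (card (Q.level (i + 2)))
      + Q.level_excess i - 2 * Q.level_excess (i + 1) + Q.level_excess (i + 2)
    = 2 * int (card (R_level (i + 2)))"
  using level_excess_diff[of i] level_excess_diff[of "i + 1"] assms
    Q.card_above[of "i + 1"] swap.Q.rev.card_above[of "i + 1"] by simp

lemma card_level_k_minus_1: "2 * int (card (Q.level (k - 1))) + Q.level_excess (k - 1) = 2 * int m"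
  using level_excess_diff[of "k - 1"] k_pos Q.above_k swap.Q.rev.above_k Q.level_excess_ends by simp

lemma card_level_1:
  "2 * int (card (Q.level 1)) + Q.level_excess 1 + 2 * int m = 2 + 2 * int (card (R_level 1))"
  using level_excess_diff[of 0] k_pos Q.level_0 Q.level_excess_ends card_sides(1)
    Q.card_Q swap.Q.rev.card_Q Q.card_above[of 0] swap.Q.rev.card_above[of 0] by simp

end

context two_cut_crossing
begin

lemma level_1_exact:
  "card (Q.level 1) = 1" "Q.level_excess 1 = 0"
  "card (R_level 1) = m" "R_level_excess 1 = 0"
proof -
  have "2 * int (card (R_level 1)) + R_level_excess 1 = 2 * int m"
    using swap.card_level_k_minus_1 swap.Q.rev_level[of 1] swap.Q.rev_level_excess[of 1] k_pos
    by simp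
  moreover have "1 \<le> card (Q.level 1)" "0 \<le> Q.level_excess 1" "0 \<le> R_level_excess 1"
    using Q.card_level_pos Q.level_excess_nonneg swap.Q.rev.level_excess_nonneg k_pos by auto
  ultimately show "card (Q.level 1) = 1" "Q.level_excess 1 = 0"
    "card (R_level 1) = m" "R_level_excess 1 = 0"
    using card_level_1 by linarith+
qed

end

context two_cut_crossing
begin

lemma level_recursion:
  "level_recursion k m (\<lambda>i. card (Q.level i)) (\<lambda>i. card (R_level i))
    Q.level_excess R_level_excess"
proof
  show "Q.level_excess (k - 1) = 0"
    using swap.level_1_exact(4) Q.rev_level_excess[of 1] k_pos by simp
next
  fix i assume i: "i + 2 \<le> k"
  define j where "j = k - (i + 2)"
  have j: "j + 2 \<le> k" "k - i = j + 2" "k - (i + 1) = j + 1" "k - (i + 2) = j" "k - (j + 2) = i"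
    using i by (auto simp: j_def)
  have "Q.rev.level (j + 2) = Q.level i" using Q.rev_level[OF j(1)] j(5) by simp
  then show "2 * int (card (R_level i)) - 2 * int (card (R_level (i + 1)))
      + 2 * int (card (R_level (i + 2)))
      + R_level_excess i - 2 * R_level_excess (i + 1) + R_level_excess (i + 2)
    = 2 * int (card (Q.level i))"
    using swap.level_excess_second_diff[OF j(1)] i j
      swap.Q.rev_level[of i] swap.Q.rev_level[of "i + 1"] swap.Q.rev_level[of "i + 2"]
      swap.Q.rev_level_excess[of i] swap.Q.rev_level_excess[of "i + 1"]
      swap.Q.rev_level_excess[of "i + 2"]
    by simp
next
  fix i assume "i + 2 \<le> k" "Q.level_excess i = 0"
    "2 * int (card (Q.level (i + 2))) + Q.level_excess (i + 2) = 2 + Q.level_excess (i + 1)"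
  then show "card (Q.level (i + 2)) = 1 \<and> Q.level_excess (i + 1) = 0 \<and> Q.level_excess (i + 2) = 0"
    using Q.level_collapse[of i] by simp
next
  fix i assume "i + 2 \<le> k" "R_level_excess i = 0"
    "2 * int (card (R_level (i + 2))) + R_level_excess (i + 2)
      = 2 + R_level_excess (i + 1)"
  then show "card (R_level (i + 2)) = 1 \<and> R_level_excess (i + 1) = 0
      \<and> R_level_excess (i + 2) = 0"
    using swap.Q.rev.level_collapse[of i] by simp
qed (use level_1_exact level_excess_second_diff Q.level_0 swap.Q.rev.level_0
    Q.level_excess_ends swap.Q.rev.level_excess_ends Q.card_level_pos swap.Q.rev.card_level_pos
    Q.level_excess_nonneg swap.Q.rev.level_excess_nonneg in simp_all)

lemma levels_W_layer:
  assumes "i \<le> k"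
  shows "card (Q.level i) = W_layer m (i + 3)" "card (R_level i) = W_layer m i"
    "Q.level_excess i = 0"
  using level_recursion.exact_W_layer[OF level_recursion assms]
    level_recursion.exact_def[OF level_recursion] by auto

lemma four_dvd_k: "m = 1 \<or> 4 dvd k"
proof -
  have "W_layer m (k + 3) = 1" "W_layer m k = 1"
    using levels_W_layer[of k] Q.level_k swap.Q.rev.level_k by simp_all
  then have "m = 1 \<or> (k mod 4 = 0 \<or> k mod 4 = 3) \<and> ((k + 3) mod 4 = 0 \<or> (k + 3) mod 4 = 3)"
    unfolding W_layer_eq_if by metis
  then show ?thesis by presburger
qed

lemma adj_Q_if_next_level:
  assumes "z \<in> Q" "w \<in> Q" "d b w = Suc (d b z)"
  shows "adj z w"
proof -
  have "Q.excess z = 0"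
    using Q.excess_eq_level_excess[OF assms(1)] levels_W_layer(3)[OF Q.d_b_le[OF assms(1)]] by simp
  then have "Q.slack w z = 0" using Q.slack_eq_0[of z w] Q.slack_commute[of w z] assms by simp
  then show ?thesis using Q.adj_if_slack_eq_0[of w z] assms adj_commute by simp
qed

end

section \<open>Circular positions\<close>

definition circular_position :: "'a set \<Rightarrow> ('a \<Rightarrow> 'a \<Rightarrow> bool) \<Rightarrow> nat \<Rightarrow> ('a \<Rightarrow> nat) \<Rightarrow> bool" where
  "circular_position V adj n pos \<longleftrightarrow> (\<forall>u\<in>V. pos u < n) \<and>
    (\<forall>u\<in>V. \<forall>v\<in>V. adj u v \<longleftrightarrow> Suc (pos u) mod n = pos v \<or> Suc (pos v) mod n = pos u)"

context two_cut_crossing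
begin

lemma adj_R_if_next_level:
  assumes "u \<in> R" "v \<in> R" "d y v = Suc (d y u)"
  shows "adj u v"
proof -
  have "d a u = Suc (d a v)" using swap.d_sum_Q[of u] swap.d_sum_Q[of v] assms by linarith
  then show ?thesis using swap.adj_Q_if_next_level[of v u] assms adj_commute by simp
qed

definition position :: "'a \<Rightarrow> nat" where
  "position u = (if u \<in> R then d y u else if u \<in> A then k + 1 else if u \<in> B then k + 2
     else k + 3 + d b u)"

lemma position_A: "u \<in> A \<Longrightarrow> position u = k + 1"
  and position_B: "u \<in> B \<Longrightarrow> position u = k + 2"
  and position_Q: "u \<in> Q \<Longrightarrow> position u = k + 3 + d b u"
  and position_R: "u \<in> R \<Longrightarrow> position u = d y u"
  using D_eq(2) parts_disjoint unfolding position_def by auto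

lemma position_cases:
  assumes "u \<in> V"
  obtains (R) "u \<in> R" "position u = d y u" "d y u \<le> k"
    | (A) "u \<in> A" "position u = k + 1"
    | (B) "u \<in> B" "position u = k + 2"
    | (Q) "u \<in> Q" "position u = k + 3 + d b u" "d b u \<le> k"
  using assms V_eq position_A[of u] position_B[of u] position_Q[of u] position_R[of u]
    Q.d_b_le[of u] swap.Q.rev.d_b_le[of u] by blast

lemma position_fibre:
  "i \<le> k \<Longrightarrow> {u \<in> V. position u = i} = R_level i"
  "{u \<in> V. position u = k + 1} = A"
  "{u \<in> V. position u = k + 2} = B"
  "{u \<in> V. position u = k + 3 + i} = Q.level i"
proof -
  have "u \<in> V \<and> position u = i \<longleftrightarrow> u \<in> R_level i" if "i \<le> k" for u
    using that position_R[of u] swap.Q.Q_V[of u]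
    by (auto simp: swap.Q.rev.level_def elim!: position_cases)
  then show "{u \<in> V. position u = i} = R_level i" if "i \<le> k" using that by blast
  have "u \<in> V \<and> position u = k + 1 \<longleftrightarrow> u \<in> A" for u
    using position_A[of u] D_V[of u] by (auto simp: nbrs_in_def elim!: position_cases)
  then show "{u \<in> V. position u = k + 1} = A" by blast
  have "u \<in> V \<and> position u = k + 2 \<longleftrightarrow> u \<in> B" for u
    using position_B[of u] D_V[of u] by (auto simp: nbrs_in_def elim!: position_cases)
  then show "{u \<in> V. position u = k + 2} = B" by blast
  have "u \<in> V \<and> position u = k + 3 + i \<longleftrightarrow> u \<in> Q.level i" for u
    using position_Q[of u] Q_V[of u] by (auto simp: Q.level_def elim!: position_cases)
  then show "{u \<in> V. position u = k + 3 + i} = Q.level i" by blast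
qed

lemma card_position_fibre:
  assumes "i < 2 * k + 4"
  shows "card {u \<in> V. position u = i} = W_layer m i"
proof -
  consider (R) "i \<le> k" | (A) "i = k + 1" | (B) "i = k + 2" | (Q) j where "i = k + 3 + j"
    using le_Suc_ex[of "k + 3" i] by fastforce
  then show ?thesis
  proof cases
    case R
    then show ?thesis using position_fibre(1) levels_W_layer(2) by simp
  next
    case A
    have "W_layer m (k + 1) = m" unfolding W_layer_eq_if using four_dvd_k by presburger
    then show ?thesis using A position_fibre(2) card_A by simp
  next
    case B
    have "W_layer m (k + 2) = m" unfolding W_layer_eq_if using four_dvd_k by presburger
    then show ?thesis using B position_fibre(3) swap.card_A by simp
  next
    case Q
    have "W_layer m (k + 3 + j) = W_layer m (j + 3)"
      unfolding W_layer_eq_if using four_dvd_k by presburger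
    moreover have "j \<le> k" using Q assms by simp
    ultimately show ?thesis using Q position_fibre(4) levels_W_layer(1) by simp
  qed
qed

lemma position_less: "u \<in> V \<Longrightarrow> position u < 2 * k + 4"
  by (elim position_cases) auto

lemma Suc_position_mod:
  assumes "u \<in> V"
  shows "Suc (position u) mod (2 * k + 4) = (if u = x then 0 else Suc (position u))"
proof (cases "u = x")
  case True
  then have "Suc (position u) = 2 * k + 4" using position_Q[OF x_in_Q] d_b_x by simp
  then show ?thesis unfolding True by (simp only: mod_self if_True simp_thms)
next
  case False
  have "{u \<in> V. position u = 2 * k + 3} = {x}"
    using position_fibre(4)[of k] Q.level_k by (simp add: mult_2 ac_simps)
  then have "position u \<noteq> 2 * k + 3" using assms False by blast
  then show ?thesis using position_less[OF assms] False by simp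
qed

lemma adj_if_position_eq_Suc:
  assumes "u \<in> V" "v \<in> V" and Suc: "position v = Suc (position u)"
  shows "adj u v"
  using assms(1)
proof (cases rule: position_cases)
  case R
  show ?thesis
  proof (cases "d y u = k")
    case True
    then have "u = a" "v \<in> A"
      using R Suc assms swap.Q.rev.level_k position_fibre(2) by (auto simp: swap.Q.rev.level_def)
    then show ?thesis by (simp add: nbrs_in_def)
  next
    case False
    then have "v \<in> R_level (Suc (d y u))"
      using R Suc assms(2) position_fibre(1)[of "Suc (d y u)"] by auto
    then show ?thesis using R adj_R_if_next_level by (simp add: swap.Q.rev.level_def)
  qed
next
  case A
  then have "v \<in> B" using Suc assms(2) position_fibre(3) by auto
  then show ?thesis by (rule adj_A_B[OF A(1)])
next
  case B
  then have "v \<in> {w \<in> V. position w = k + 3 + 0}" using Suc assms(2) by simp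
  then have "v \<in> Q.level 0" unfolding position_fibre(4) .
  then show ?thesis using B Q.level_0 adj_commute by (simp add: nbrs_in_def)
next
  case Q
  then have "v \<in> Q.level (Suc (d b u))"
    using Suc assms(2) position_fibre(4)[of "Suc (d b u)"] by auto
  then show ?thesis using Q adj_Q_if_next_level by (simp add: Q.level_def)
qed

lemma adj_if_Suc_position_mod:
  assumes "u \<in> V" "v \<in> V" and Suc: "Suc (position u) mod (2 * k + 4) = position v"
  shows "adj u v"
proof (cases "u = x")
  case True
  then have "v \<in> R_level 0"
    using Suc Suc_position_mod assms position_fibre(1)[of 0] by auto
  then show ?thesis using True swap.Q.rev.level_0 adj_x_y by simp
next
  case False
  then show ?thesis using Suc Suc_position_mod assms by (intro adj_if_position_eq_Suc) simp_all
qed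

lemma position_if_adj:
  assumes uv: "adj u v"
  shows "position v = Suc (position u) \<or> position u = Suc (position v)
    \<or> u = x \<and> v = y \<or> u = y \<and> v = x"
proof -
  have "u \<in> V" using adj_V[OF uv] by simp
  then show ?thesis
  proof (cases rule: position_cases)
    case R
    then consider "v \<in> R" | "u = a" "v \<in> A" | "u = y" "v = x" using swap.adj_Q[OF R(1) uv] by blast
    then show ?thesis
      using R position_R[of v] position_A[of v] d_adj_cases[OF uv ends_V(2)]
        d_commute[of y a] d_ends
      by cases auto
  next
    case A
    then consider "v = a" | "v \<in> B" using adj_A[OF A(1) uv] by blast
    then show ?thesis
      using A position_B[of v] position_R[OF cut_in_sides(1)] d_commute[of y a] d_ends
      by cases auto
  next
    case B
    then consider "v = b" | "v \<in> A" using swap.adj_A[OF B(1) uv] by blast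
    then show ?thesis
      using B position_A[of v] position_Q[OF cut_in_sides(2)] cut_V by cases auto
  next
    case Q
    then consider "v \<in> Q" | "u = b" "v \<in> B" | "u = x" "v = y" using adj_Q[OF Q(1) uv] by blast
    then show ?thesis
      using Q position_Q[of v] position_B[of v] d_adj_cases[OF uv cut_V(2)] cut_V by cases auto
  qed
qed

lemma Suc_position_mod_if_adj:
  assumes "adj u v"
  shows "Suc (position u) mod (2 * k + 4) = position v
    \<or> Suc (position v) mod (2 * k + 4) = position u"
proof -
  have V: "u \<in> V" "v \<in> V" using adj_V[OF assms] by auto
  have "position y = 0" using position_R[OF y_in_R] ends_V by simp
  then show ?thesis
    using position_if_adj[OF assms] position_less V Suc_position_mod[of x] ends_V by fastforce
qed

lemma circular_position: "circular_position V adj (2 * k + 4) position"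
  unfolding circular_position_def
  using position_less adj_if_Suc_position_mod Suc_position_mod_if_adj adj_commute by blast

end

context balanced_metric
begin

lemma two_cut_circular_position:
  assumes d_a_b: "d a b = 3" and separates: "separates {a, b} C"
    and nonempty: "C \<noteq> {}" "V - {a, b} - C \<noteq> {}"
  obtains k m pos where "1 \<le> k" "1 \<le> m" "m = 1 \<or> 4 dvd k"
    "circular_position V adj (2 * k + 4) pos"
    "\<And>i. i < 2 * k + 4 \<Longrightarrow> card {u \<in> V. pos u = i} = W_layer m i"
proof -
  have V: "a \<in> V" "b \<in> V" "C \<subseteq> V - {a, b}" "a \<noteq> b"
    using separates d_a_b by (auto simp: separates_def)
  have "V \<inter> {a, b} = {a, b}" "(V - {a, b}) \<inter> C = C" using V by blast+
  then have "card V = 2 + (card C + card (V - {a, b} - C))"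
    using card_Int_Diff[of V "{a, b}"] card_Int_Diff[of "V - {a, b}" C] finite_V V(4) by simp
  then obtain D where "separates {a, b} D" "D \<noteq> {}" "2 * card D + 2 \<le> card V"
  proof (cases "card C \<le> card (V - {a, b} - C)")
    case False
    then show ?thesis
      using that[of "V - {a, b} - C"] separates_complement[OF separates] nonempty \<open>card V = _\<close>
      by simp
  qed (use separates nonempty in simp)
  then interpret two_cut_side V adj d a b D
    using d_a_b by unfold_locales
  obtain x y where "x \<in> Q" "y \<in> R" "adj x y" using crossing_edge_exists by blast
  then interpret two_cut_crossing V adj d a b D x y "d b x" "card A"
    by unfold_locales simp_all
  show ?thesis
    using that k_pos m_pos four_dvd_k circular_position card_position_fibre .
qed

end

section \<open>Distances in graphs\<close>

definition rel_dist :: "('a \<times> 'a) set \<Rightarrow> 'a \<Rightarrow> 'a \<Rightarrow> nat" where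
  "rel_dist r u v = (LEAST n. (u, v) \<in> r ^^ n)"

lemma rel_dist_le: "(u, v) \<in> r ^^ n \<Longrightarrow> rel_dist r u v \<le> n"
  unfolding rel_dist_def by (rule Least_le)

lemma relpow_rel_dist: "(u, v) \<in> r\<^sup>* \<Longrightarrow> (u, v) \<in> r ^^ rel_dist r u v"
  unfolding rel_dist_def by (rule LeastI_ex) (rule rtrancl_imp_relpow)

lemma rel_dist_eq_0_iff: "(u, v) \<in> r\<^sup>* \<Longrightarrow> rel_dist r u v = 0 \<longleftrightarrow> u = v"
  using relpow_rel_dist[of u v r] rel_dist_le[of u v 0 r] by auto

lemma rel_dist_triangle:
  assumes "(u, v) \<in> r\<^sup>*" "(v, w) \<in> r\<^sup>*"
  shows "rel_dist r u w \<le> rel_dist r u v + rel_dist r v w"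
  using relpow_trans[OF relpow_rel_dist[OF assms(1)] relpow_rel_dist[OF assms(2)]]
  by (rule rel_dist_le)

lemma sym_relpow:
  assumes "sym r"
  shows "sym (r ^^ n)"
proof (induction n)
  case (Suc n)
  show ?case
  proof (rule symI)
    fix u v assume "(u, v) \<in> r ^^ Suc n"
    then obtain w where "(u, w) \<in> r ^^ n" "(w, v) \<in> r" by auto
    then have "(w, u) \<in> r ^^ n" "(v, w) \<in> r" using Suc.IH assms by (auto dest: symD)
    then show "(v, u) \<in> r ^^ Suc n" by (rule relpow_Suc_I2[rotated])
  qed
qed (simp add: sym_Id)

lemma rel_dist_commute:
  assumes "sym r"
  shows "rel_dist r u v = rel_dist r v u"
  using sym_relpow[OF assms] unfolding rel_dist_def by (metis symD)

lemma rel_dist_eq_1_iff: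
  assumes "irrefl r" "(u, v) \<in> r\<^sup>*"
  shows "rel_dist r u v = 1 \<longleftrightarrow> (u, v) \<in> r"
proof
  assume "rel_dist r u v = 1"
  then show "(u, v) \<in> r" using relpow_rel_dist[OF assms(2)] by simp
next
  assume uv: "(u, v) \<in> r"
  then have "u \<noteq> v" using assms(1) by (auto simp: irrefl_def)
  then have "rel_dist r u v \<noteq> 0" using rel_dist_eq_0_iff[OF assms(2)] by simp
  moreover have "rel_dist r u v \<le> 1" using uv by (intro rel_dist_le) simp
  ultimately show "rel_dist r u v = 1" by simp
qed

lemma rel_dist_step:
  assumes "(u, v) \<in> r\<^sup>*" "u \<noteq> v"
  shows "\<exists>w. (u, w) \<in> r \<and> rel_dist r u v = Suc (rel_dist r w v)"
proof -
  obtain n where n: "rel_dist r u v = Suc n"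
    using rel_dist_eq_0_iff[OF assms(1)] assms(2) by (cases "rel_dist r u v") auto
  then obtain w where w: "(u, w) \<in> r" "(w, v) \<in> r ^^ n"
    using relpow_rel_dist[OF assms(1)] by (metis relpow_Suc_D2)
  have "(w, v) \<in> r ^^ rel_dist r w v"
    using relpow_imp_rtrancl[OF w(2)] by (rule relpow_rel_dist)
  then have "(u, v) \<in> r ^^ Suc (rel_dist r w v)" by (rule relpow_Suc_I2[OF w(1)])
  then have "rel_dist r u v \<le> Suc (rel_dist r w v)" by (rule rel_dist_le)
  moreover have "rel_dist r w v \<le> n" using w(2) by (rule rel_dist_le)
  ultimately show ?thesis using w(1) n by (intro exI[of _ w]) simp
qed

lemma graph_metric_rel_dist:
  assumes "r \<subseteq> V \<times> V" "sym r" "irrefl r" and conn: "\<And>u v. u \<in> V \<Longrightarrow> v \<in> V \<Longrightarrow> (u, v) \<in> r\<^sup>*"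
  shows "graph_metric V (\<lambda>u v. (u, v) \<in> r) (rel_dist r)"
proof
  show "rel_dist r u v = rel_dist r v u" for u v
    by (rule rel_dist_commute[OF \<open>sym r\<close>])
  show "rel_dist r u w \<le> rel_dist r u v + rel_dist r v w"
    if "u \<in> V" "v \<in> V" "w \<in> V" for u v w
    using that by (intro rel_dist_triangle conn)
qed (use assms rel_dist_eq_0_iff[of _ _ r] rel_dist_eq_1_iff[of r] rel_dist_step[of _ _ r] in auto)

lemma even_relpow_bipartite:
  assumes "r \<subseteq> X \<times> Y \<union> Y \<times> X" "X \<inter> Y = {}" "(u, v) \<in> r ^^ n"
  shows "even n \<longleftrightarrow> (u \<in> X \<longleftrightarrow> v \<in> X)"
  using assms(3)
proof (induction n arbitrary: v)
  case (Suc n)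
  then obtain w where w: "(u, w) \<in> r ^^ n" "(w, v) \<in> r" by (auto elim: relpow_Suc_E)
  then have "w \<in> X \<longleftrightarrow> v \<notin> X" using assms(1,2) by auto
  then show ?case using Suc.IH[OF w(1)] by auto
qed simp

context wf_digraph
begin

lemma arcs_ends_subset: "arcs_ends G \<subseteq> verts G \<times> verts G"
  using adj_in_verts by auto

lemma awalk_of_length_iff_relpow:
  assumes "u \<in> verts G"
  shows "(\<exists>p. awalk u p v \<and> length p = n) \<longleftrightarrow> (u, v) \<in> arcs_ends G ^^ n"
  using assms
proof (induction n arbitrary: u)
  case 0
  then show ?case by (auto simp: awalk_Nil_iff)
next
  case (Suc n)
  have "(\<exists>p. awalk u p v \<and> length p = Suc n) \<longleftrightarrow> (\<exists>e p. awalk u (e # p) v \<and> length p = n)"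
    by (metis length_Suc_conv)
  also have "\<dots> \<longleftrightarrow> (\<exists>e\<in>arcs G. tail G e = u \<and> (\<exists>p. awalk (head G e) p v \<and> length p = n))"
    by (auto simp: awalk_Cons_iff)
  also have "\<dots> \<longleftrightarrow> (\<exists>e\<in>arcs G. tail G e = u \<and> (head G e, v) \<in> arcs_ends G ^^ n)"
    using Suc.IH by auto
  also have "\<dots> \<longleftrightarrow> (\<exists>w. u \<rightarrow> w \<and> (w, v) \<in> arcs_ends G ^^ n)"
    by (metis in_arcs_imp_in_arcs_ends reachableE)
  also have "\<dots> \<longleftrightarrow> (u, v) \<in> arcs_ends G ^^ Suc n"
    by (metis relpow_Suc_D2 relpow_Suc_I2)
  finally show ?case .
qed

lemma gdist_eq_rel_dist:
  assumes "u \<rightarrow>\<^sup>* v"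
  shows "gdist G u v = ereal (real (rel_dist (arcs_ends G) u v))"
  using gdist_eq_Least_length[OF wf_digraph assms] awalk_of_length_iff_relpow
    reachable_in_verts(1)[OF assms] by (simp add: rel_dist_def)

end

context sym_digraph
begin

lemma connected_imp_reachable:
  assumes "connected G" "u \<in> verts G" "v \<in> verts G"
  shows "u \<rightarrow>\<^sup>* v"
  using symmetric_connected_imp_strongly_connected[OF sym_arcs assms(1)] assms(2,3) by blast

lemma not_connected_imp_closed_subset:
  assumes "\<not> connected G" "verts G \<noteq> {}"
  obtains C where "C \<noteq> {}" "C \<subset> verts G" "\<And>p q. p \<in> C \<Longrightarrow> p \<rightarrow> q \<Longrightarrow> q \<in> C"
proof -
  obtain u v where uv: "u \<in> verts G" "v \<in> verts G" "\<not> u \<rightarrow>\<^sup>* v"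
    using assms
    by (auto simp: connected_def strongly_connected_def reachable_mk_symmetric_eq[OF sym_arcs])
  show ?thesis
    using that[of "{w. u \<rightarrow>\<^sup>* w}"] uv reachable_in_verts(2) reachable_adj_trans by blast
qed

end

context graph
begin

lemma bipartite_metric_rel_dist:
  assumes conn: "connected G" and "bipartite G"
  shows "bipartite_metric (verts G) (dominates G) (rel_dist (arcs_ends G))"
proof -
  have rtrancl: "(u, v) \<in> (arcs_ends G)\<^sup>*" if "u \<in> verts G" "v \<in> verts G" for u v
    using connected_imp_reachable[OF conn that] by (rule reachable_rtranclI)
  obtain X Y where XY: "arcs_ends G \<subseteq> X \<times> Y \<union> Y \<times> X" "X \<inter> Y = {}"
    using \<open>bipartite G\<close> by (auto simp: bipartite_def)
  have metric: "graph_metric (verts G) (dominates G) (rel_dist (arcs_ends G))"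
    using arcs_ends_subset sym_arcs adj_not_same rtrancl
    by (intro graph_metric_rel_dist) (auto simp: symmetric_def irrefl_def)
  have "rel_dist (arcs_ends G) z u \<noteq> rel_dist (arcs_ends G) z v"
    if uv: "u \<rightarrow> v" and z: "z \<in> verts G" for u v z
  proof -
    have "even (rel_dist (arcs_ends G) z w) \<longleftrightarrow> (z \<in> X \<longleftrightarrow> w \<in> X)" if "w \<in> verts G" for w
      using even_relpow_bipartite[OF XY relpow_rel_dist[OF rtrancl[OF z that]]] .
    moreover have "u \<in> X \<longleftrightarrow> v \<notin> X" using uv XY by auto
    ultimately show ?thesis using adj_in_verts[OF uv] by metis
  qed
  then show ?thesis
    using metric by (intro bipartite_metric.intro bipartite_metric_axioms.intro)
qed

lemma balanced_metric_rel_dist: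
  assumes "bipartite G" "distance_balanced G"
  shows "balanced_metric (verts G) (dominates G) (rel_dist (arcs_ends G))"
proof -
  have conn: "connected G" using assms(2) by (simp add: distance_balanced_def)
  interpret bipartite_metric "verts G" "dominates G" "rel_dist (arcs_ends G)"
    by (rule bipartite_metric_rel_dist[OF conn assms(1)])
  have closer: "closer_set G u v = closer u v" if "u \<in> verts G" "v \<in> verts G" for u v
    using gdist_eq_rel_dist connected_imp_reachable[OF conn] that
    by (auto simp: closer_set_def closer_def)
  show ?thesis
  proof unfold_locales
    fix u v assume uv: "u \<rightarrow> v"
    then have "card (closer_set G u v) = card (closer_set G v u)"
      using assms(2) unfolding distance_balanced_def by blast
    then show "card (closer u v) = card (closer v u)" using closer adj_in_verts[OF uv] by simp
  qed simp
qed

lemma two_cut_closed_set: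
  assumes "two_cut G S"
  obtains C where "C \<noteq> {}" "C \<subset> verts G - S" "\<And>p q. p \<in> C \<Longrightarrow> p \<rightarrow> q \<Longrightarrow> q \<in> C \<union> S"
proof -
  let ?W = "verts G - S"
  interpret W: sym_digraph "G \<restriction> ?W"
    by (rule induced_graph_imp_graph) (rule induced_induce, blast)
  have "\<not> connected (G \<restriction> ?W)" "verts (G \<restriction> ?W) \<noteq> {}"
    using assms by (auto simp: two_cut_def)
  then obtain C where C: "C \<noteq> {}" "C \<subset> ?W" "\<And>p q. p \<in> C \<Longrightarrow> p \<rightarrow>\<^bsub>G \<restriction> ?W\<^esub> q \<Longrightarrow> q \<in> C"
    using W.not_connected_imp_closed_subset by auto
  have "q \<in> C \<union> S" if p: "p \<in> C" and pq: "p \<rightarrow> q" for p q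
  proof (cases "q \<in> S")
    case False
    then have "p \<rightarrow>\<^bsub>G \<restriction> ?W\<^esub> q" using p pq C(2) adj_in_verts[OF pq] by (auto simp: arcs_ends_conv)
    then show ?thesis using C(3)[OF p] by blast
  qed simp
  then show ?thesis using that C(1,2) by blast
qed

end

section \<open>Isomorphisms onto circular graphs\<close>

lemma (in nomulti_digraph) digraph_iso_with_projI:
  assumes f: "bij_betw f (verts G) (pverts H)"
    and arcs: "parcs H = map_prod f f ` arcs_ends G"
  shows "digraph_iso G (with_proj H)"
proof -
  define h where "h = \<lparr> iso_verts = f, iso_arcs = map_prod f f \<circ> arc_to_ends G,
    iso_head = snd, iso_tail = fst \<rparr>"
  have "inj_on (map_prod f f) (arcs_ends G)"
    using bij_betw_imp_inj_on[OF f] arcs_ends_subset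
    by (intro inj_on_subset[OF map_prod_inj_on]) auto
  then have "inj_on (map_prod f f \<circ> arc_to_ends G) (arcs G)"
    using inj_on_arc_to_ends by (intro comp_inj_on) (simp_all add: arcs_ends_def)
  then have "digraph_isomorphism h"
    using bij_betw_imp_inj_on[OF f] wf_digraph
    by (simp add: digraph_isomorphism_def h_def arc_to_ends_def)
  moreover have "with_proj H = app_iso h G"
    using f arcs
    by (simp add: app_iso_def h_def with_proj_def bij_betw_def arcs_ends_def image_comp)
  ultimately show ?thesis by (auto simp: digraph_iso_def)
qed

lemma (in nomulti_digraph) digraph_iso_with_projI_dominates:
  assumes f: "bij_betw f (verts G) (pverts H)"
    and H: "parcs H \<subseteq> pverts H \<times> pverts H"
    and iff: "\<And>u v. u \<in> verts G \<Longrightarrow> v \<in> verts G \<Longrightarrow> u \<rightarrow> v \<longleftrightarrow> (f u, f v) \<in> parcs H"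
  shows "digraph_iso G (with_proj H)"
proof (rule digraph_iso_with_projI[OF f])
  show "parcs H = map_prod f f ` arcs_ends G"
  proof (intro equalityI subsetI)
    fix p assume p: "p \<in> parcs H"
    then obtain u v where "u \<in> verts G" "v \<in> verts G" "p = (f u, f v)"
      using H bij_betw_imp_surj_on[OF f] by blast
    then show "p \<in> map_prod f f ` arcs_ends G" using iff p by force
  next
    fix p assume "p \<in> map_prod f f ` arcs_ends G"
    then obtain u v where uv: "u \<rightarrow> v" "p = (f u, f v)" by auto
    then show "p \<in> parcs H" using iff[of u v] adj_in_verts[OF uv(1)] by simp
  qed
qed

lemma cong_diff_eq_1_iff:
  assumes "j < n"
  shows "[int j - int i = 1] (mod int n) \<longleftrightarrow> Suc i mod n = j"
proof -
  have "[int j - int i = 1] (mod int n) \<longleftrightarrow> [int j = int (Suc i)] (mod int n)"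
    by (simp add: cong_iff_dvd_diff algebra_simps)
  also have "\<dots> \<longleftrightarrow> [j = Suc i] (mod n)" by (rule cong_int_iff)
  also have "\<dots> \<longleftrightarrow> Suc i mod n = j" using assms by (auto simp: cong_def)
  finally show ?thesis .
qed

lemma circular_position_cong:
  assumes "circular_position V adj n pos" "u \<in> V" "v \<in> V"
  shows "adj u v \<longleftrightarrow> [int (pos v) - int (pos u) = 1] (mod int n)
    \<or> [int (pos v) - int (pos u) = -1] (mod int n)"
  using assms by (simp add: circular_position_def cong_diff_eq_1_iff cong_diff_swap_iff)

lemma ex_bij_betw_Sigma_fibres:
  assumes "finite V" "pos ` V \<subseteq> I" and card: "\<And>i. i \<in> I \<Longrightarrow> card {u \<in> V. pos u = i} = c i"
  obtains g where "bij_betw (\<lambda>u. (pos u, g u)) V (SIGMA i:I. {1..c i})"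
proof -
  define P where "P i = {u \<in> V. pos u = i}" for i
  have "\<exists>h. bij_betw h (P i) {1..c i}" if "i \<in> I" for i
    using card[OF that] assms(1) by (intro finite_same_card_bij) (simp_all add: P_def)
  then obtain h where h: "\<And>i. i \<in> I \<Longrightarrow> bij_betw (h i) (P i) {1..c i}" by metis
  define f where "f = (\<lambda>u. (pos u, h (pos u) u))"
  have "inj_on f V"
  proof (rule inj_onI)
    fix u v assume "u \<in> V" "v \<in> V" "f u = f v"
    then have pos: "pos u \<in> I" "u \<in> P (pos u)" "v \<in> P (pos u)" "h (pos u) u = h (pos u) v"
      using assms(2) by (auto simp: f_def P_def)
    then show "u = v" using bij_betw_imp_inj_on[OF h[OF pos(1)]] by (blast dest: inj_onD)
  qed
  moreover have "f ` V = (SIGMA i:I. {1..c i})"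
  proof (intro equalityI subsetI)
    fix p assume "p \<in> f ` V"
    then obtain u where u: "u \<in> P (pos u)" "pos u \<in> I" "p = f u"
      using assms(2) by (auto simp: P_def)
    then show "p \<in> (SIGMA i:I. {1..c i})" using bij_betwE[OF h[OF u(2)]] by (simp add: f_def)
  next
    fix p assume "p \<in> (SIGMA i:I. {1..c i})"
    then obtain i j where "p = (i, j)" "i \<in> I" "j \<in> h i ` P i"
      using h by (auto simp: bij_betw_def)
    then show "p \<in> f ` V" by (auto simp: P_def f_def)
  qed
  ultimately show ?thesis using that[of "\<lambda>u. h (pos u) u"] by (simp add: bij_betw_def f_def)
qed

context graph
begin

lemma is_cycle_graph_if_circular_position:
  assumes circ: "circular_position (verts G) (dominates G) n pos" and "n \<ge> 3"
    and single: "\<And>i. i < n \<Longrightarrow> card {u \<in> verts G. pos u = i} = 1"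
  shows "is_cycle_graph G"
proof -
  have less: "pos u < n" if "u \<in> verts G" for u
    using circ that by (simp add: circular_position_def)
  have "\<exists>!u. u \<in> verts G \<and> pos u = i" if i: "i < n" for i
  proof -
    obtain w where "{u \<in> verts G. pos u = i} = {w}" using single[OF i] by (rule card_1_singletonE)
    then show ?thesis by (intro ex1I[of _ w]) auto
  qed
  then have "bij_betw pos (verts G) (pverts (cycle_graph n))"
    using less by (intro bij_betw_imageI inj_onI) (auto simp: cycle_graph_def, blast+)
  then have "digraph_iso G (with_proj (cycle_graph n))"
    using circular_position_cong[OF circ] less
    by (intro digraph_iso_with_projI_dominates) (auto simp: cycle_graph_def)
  then show ?thesis using \<open>n \<ge> 3\<close> by (auto simp: is_cycle_graph_def)
qed

lemma digraph_iso_W_graph_if_circular_position: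
  assumes circ: "circular_position (verts G) (dominates G) (4 * l) pos"
    and layers: "\<And>i. i < 4 * l \<Longrightarrow> card {u \<in> verts G. pos u = i} = W_layer m i"
  shows "digraph_iso G (with_proj (W_graph m l))"
proof -
  have "pos ` verts G \<subseteq> {..<4 * l}" using circ by (auto simp: circular_position_def)
  then obtain g where
    "bij_betw (\<lambda>u. (pos u, g u)) (verts G) (SIGMA i:{..<4 * l}. {1..W_layer m i})"
    using layers by (elim ex_bij_betw_Sigma_fibres[rotated]) auto
  moreover have "(SIGMA i:{..<4 * l}. {1..W_layer m i}) = W_verts m l" by (auto simp: W_verts_def)
  ultimately have bij: "bij_betw (\<lambda>u. (pos u, g u)) (verts G) (W_verts m l)" by simp
  then have "(pos u, g u) \<in> W_verts m l" if "u \<in> verts G" for u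
    using that by (auto dest: bij_betwE)
  then show ?thesis
    using bij circular_position_cong[OF circ]
    by (intro digraph_iso_with_projI_dominates[of "\<lambda>u. (pos u, g u)"]) (auto simp: W_graph_def)
qed

lemma cycle_or_W_graph_if_circular_position:
  assumes circ: "circular_position (verts G) (dominates G) (2 * k + 4) pos"
    and layers: "\<And>i. i < 2 * k + 4 \<Longrightarrow> card {u \<in> verts G. pos u = i} = W_layer m i"
    and "1 \<le> k" "1 \<le> m" and period: "m = 1 \<or> 4 dvd k"
  shows "is_cycle_graph G \<or>
    (\<exists>m l. m \<ge> 2 \<and> l \<ge> 3 \<and> odd l \<and> digraph_iso G (with_proj (W_graph m l)))"
proof (cases "m = 1")
  case True
  then show ?thesis
    using is_cycle_graph_if_circular_position[OF circ] layers by (simp add: W_layer_def)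
next
  case False
  then obtain c where "k = 4 * c" using period by blast
  then have l: "2 * k + 4 = 4 * (2 * c + 1)" "1 \<le> c" using \<open>1 \<le> k\<close> by simp_all
  have "digraph_iso G (with_proj (W_graph m (2 * c + 1)))"
    using circ layers unfolding l(1) by (rule digraph_iso_W_graph_if_circular_position)
  moreover have "m \<ge> 2" "2 * c + 1 \<ge> 3" "odd (2 * c + 1)" using False \<open>1 \<le> m\<close> l by simp_all
  ultimately show ?thesis by blast
qed

end

theorem theorem3p7:
  fixes G :: "('a, 'b) pre_digraph"
  assumes "graph G"
    and "bipartite G"
    and "distance_balanced G"
    and "\<exists>a b. two_cut G {a, b} \<and> gdist G a b = 3"
  shows "is_cycle_graph G \<or>
    (\<exists>m l. m \<ge> 2 \<and> l \<ge> 3 \<and> odd l \<and> digraph_iso G (with_proj (W_graph m l)))"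
proof -
  interpret graph G by fact
  interpret balanced_metric "verts G" "dominates G" "rel_dist (arcs_ends G)"
    using assms(2,3) by (rule balanced_metric_rel_dist)
  obtain a b where cut: "two_cut G {a, b}" and "gdist G a b = 3" using assms(4) by blast
  have ab: "a \<in> verts G" "b \<in> verts G" using cut by (auto simp: two_cut_def)
  then have "ereal (real (rel_dist (arcs_ends G) a b)) = ereal 3"
    using assms(3) \<open>gdist G a b = 3\<close> gdist_eq_rel_dist connected_imp_reachable
    by (simp add: distance_balanced_def)
  then have d_a_b: "rel_dist (arcs_ends G) a b = 3" by simp
  obtain C where C: "C \<noteq> {}" "C \<subset> verts G - {a, b}"
    "\<And>p q. p \<in> C \<Longrightarrow> p \<rightarrow>\<^bsub>G\<^esub> q \<Longrightarrow> q \<in> C \<union> {a, b}"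
    using two_cut_closed_set[OF cut] by blast
  have "separates {a, b} C" "verts G - {a, b} - C \<noteq> {}"
    using ab C unfolding separates_def by blast+
  then show ?thesis
    by (rule two_cut_circular_position[OF d_a_b _ C(1)])
      (rule cycle_or_W_graph_if_circular_position)
qed

end
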